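(* Let $r\geq 2$ and $h\geq 1$ be integers, let $k\ge 1$ and $\delta\ge 1$ be integers, and let $n\geq k+r(h+1)$. Let $G$ be a graph on $n$ vertices with $\kappa^h_r(G)=k$ and minimum degree $\delta(G)=\delta$, i.e. $G\in\mathcal{G}_{n,\delta}^{\kappa_r^h}$ with $\kappa^h_r=k$. Then $$\rho(G)\leq \rho\big(G^{k,\delta}_n\big),$$ with equality if and only if $G\cong G^{k,\delta}_n$.
   Context: All graphs are finite and simple; $\rho(G)$ denotes the spectral radius (largest eigenvalue) of the adjacency matrix of $G$. $K_m$ is the complete graph on $m$ vertices, $\vee$ denotes the join and $\cup$ the disjoint union of graphs, and $sK_m$ denotes $s$ disjoint copies of $K_m$. For integers $r\ge 2$, $h\ge 0$, the $h$-extra $r$-component connectivity $\kappa^h_r(G)$ of a graph $G$ is the minimum size of a vertex subset $S\subseteq V(G)$ such that $G-S$ is disconnected, has at least $r$ connected components, and every component of $G-S$ has at least $h+1$ vertices. $\mathcal{G}_{n,\delta}^{\kappa_r^h}$ denotes the set of graphs on $n$ vertices with $h$-extra $r$-component connectivity $\kappa^h_r$ and minimum degree $\delta$. The graph $G^{k,\delta}_n$ (with $k=\kappa^h_r$) is defined as follows. (i) If $\delta\le k$: take $K_{k}\vee\big(K_{n-k-(r-1)(h+1)}\cup (r-2)K_{h+1}\cup K_h\big)$ together with one further isolated vertex $w$ (i.e. the graph $K_k\vee(K_{n-k-(r-1)(h+1)}\cup (r-2)K_{h+1}\cup K_h)\cup K_1$); add $\delta-1$ edges joining $w$ to $\delta-1$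 vertices of the $K_k$, and then add one edge joining $w$ to a vertex of the $K_h$. (ii) If $k+1\le \delta< k+h$: take $K_{k}\vee\big(K_{n-k-(r-1)(h+1)}\cup (r-2)K_{h+1}\cup K_h\cup K_1\big)$ and add $\delta-k$ edges joining the vertex of the $K_1$ to $\delta-k$ vertices of the $K_h$. (iii) If $\delta\ge k+h$: $G^{k,\delta}_n= K_{k}\vee\big(K_{n-k-(r-1)(\delta-k+1)}\cup (r-1)K_{\delta-k+1}\big)$. *)

theory Defs
  imports "Jordan_Normal_Form.Char_Poly"
begin

definition simple_graph :: "nat \<Rightarrow> (nat \<Rightarrow> nat \<Rightarrow> bool) \<Rightarrow> bool" where
  "simple_graph n E \<longleftrightarrow> (\<forall>u v. E u v \<longrightarrow> u < n \<and> v < n \<and> u \<noteq> v \<and> E v u)"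

definition adj_mat :: "nat \<Rightarrow> (nat \<Rightarrow> nat \<Rightarrow> bool) \<Rightarrow> real mat" where
  "adj_mat n E = mat n n (\<lambda>(i, j). if E i j then 1 else 0)"

definition spec_rad :: "nat \<Rightarrow> (nat \<Rightarrow> nat \<Rightarrow> bool) \<Rightarrow> real" where
  "spec_rad n E = Max {x. eigenvalue (adj_mat n E) x}"

definition degree :: "nat \<Rightarrow> (nat \<Rightarrow> nat \<Rightarrow> bool) \<Rightarrow> nat \<Rightarrow> nat" where
  "degree n E v = card {u. u < n \<and> E v u}"

definition min_degree :: "nat \<Rightarrow> (nat \<Rightarrow> nat \<Rightarrow> bool) \<Rightarrow> nat" where
  "min_degree n E = Min (degree n E ` {0..<n})"

definition components_del :: "nat \<Rightarrow> (nat \<Rightarrow> nat \<Rightarrow> bool) \<Rightarrow> nat set \<Rightarrow> nat set set" where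
  "components_del n E S =
     (let V = {0..<n} - S;
          R = (\<lambda>x y. E x y \<and> x \<in> V \<and> y \<in> V)\<^sup>*\<^sup>*
      in (\<lambda>x. {y \<in> V. R x y}) ` V)"

definition hr_cut :: "nat \<Rightarrow> (nat \<Rightarrow> nat \<Rightarrow> bool) \<Rightarrow> nat \<Rightarrow> nat \<Rightarrow> nat set \<Rightarrow> bool" where
  "hr_cut n E r h S \<longleftrightarrow> S \<subseteq> {0..<n} \<and>
     card (components_del n E S) \<ge> 2 \<and>
     card (components_del n E S) \<ge> r \<and>
     (\<forall>C \<in> components_del n E S. card C \<ge> h + 1)"

definition kappa_hr :: "nat \<Rightarrow> (nat \<Rightarrow> nat \<Rightarrow> bool) \<Rightarrow> nat \<Rightarrow> nat \<Rightarrow> nat" where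
  "kappa_hr n E r h =
     (if \<exists>S. hr_cut n E r h S then Min (card ` {S. hr_cut n E r h S}) else 0)"

definition graph_iso :: "nat \<Rightarrow> (nat \<Rightarrow> nat \<Rightarrow> bool) \<Rightarrow> (nat \<Rightarrow> nat \<Rightarrow> bool) \<Rightarrow> bool" where
  "graph_iso n E F \<longleftrightarrow> (\<exists>f. bij_betw f {0..<n} {0..<n} \<and>
      (\<forall>u \<in> {0..<n}. \<forall>v \<in> {0..<n}. E u v \<longleftrightarrow> F (f u) (f v)))"

text \<open>The extremal graph G^{k,delta}_n, on vertex set {0..<n}.
  Vertices 0..<k form the K_k. Remaining vertices are arranged in consecutive blocks:
  block 0 = [k, k+m) (the large clique), then blocks of size c.\<close>
definition blk :: "nat \<Rightarrow> nat \<Rightarrow> nat \<Rightarrow> nat \<Rightarrow> nat" where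
  "blk k m c v = (if v < k + m then 0 else Suc ((v - k - m) div c))"

text \<open>Case (iii), delta >= k + h: K_k join (K_m u (r-1) K_c), c = delta-k+1,
  m = n - k - (r-1) c.\<close>
definition Gext3 :: "nat \<Rightarrow> nat \<Rightarrow> nat \<Rightarrow> nat \<Rightarrow> nat \<Rightarrow> nat \<Rightarrow> bool" where
  "Gext3 n k \<delta> r u v =
     (let c = \<delta> - k + 1; m = n - k - (r - 1) * c
      in u < n \<and> v < n \<and> u \<noteq> v \<and> (u < k \<or> v < k \<or> blk k m c u = blk k m c v))"

text \<open>Cases (i), (ii): the vertices 0..<n-1 form K_k join (K_m u (r-2) K_{h+1} u K_h)
  with m = n - k - (r-1)(h+1); the K_h occupies [p, n-1) with p = k + m + (r-2)(h+1);
  the extra vertex w = n-1 has neighbourhood given by wnb.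
  (i) delta <= k: w adjacent to delta-1 vertices of K_k (0..<delta-1) and one vertex (p) of K_h.
  (ii) k+1 <= delta < k+h: w adjacent to all of K_k and to delta-k vertices of K_h.\<close>
definition wnb :: "nat \<Rightarrow> nat \<Rightarrow> nat \<Rightarrow> nat \<Rightarrow> nat \<Rightarrow> nat \<Rightarrow> bool" where
  "wnb n k \<delta> r h u =
     (let m = n - k - (r - 1) * (h + 1); p = k + m + (r - 2) * (h + 1)
      in if \<delta> \<le> k then (u < \<delta> - 1 \<or> u = p)
         else (u < k \<or> (p \<le> u \<and> u < p + (\<delta> - k))))"

definition Gext12 :: "nat \<Rightarrow> nat \<Rightarrow> nat \<Rightarrow> nat \<Rightarrow> nat \<Rightarrow> nat \<Rightarrow> nat \<Rightarrow> bool" where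
  "Gext12 n k \<delta> r h u v =
     (let m = n - k - (r - 1) * (h + 1); w = n - 1
      in u < n \<and> v < n \<and> u \<noteq> v \<and>
         (if u = w then wnb n k \<delta> r h v
          else if v = w then wnb n k \<delta> r h u
          else (u < k \<or> v < k \<or> blk k m (h + 1) u = blk k m (h + 1) v)))"

definition Gext :: "nat \<Rightarrow> nat \<Rightarrow> nat \<Rightarrow> nat \<Rightarrow> nat \<Rightarrow> nat \<Rightarrow> nat \<Rightarrow> bool" where
  "Gext n k \<delta> r h = (if k + h \<le> \<delta> then Gext3 n k \<delta> r else Gext12 n k \<delta> r h)"

end

theory Submission
  imports Defs "HOL-Analysis.Function_Topology"
begin

text \<open>
  Let \<open>S\<close> be a minimum cut of \<open>G\<close> and \<open>v\<close> a vertex of minimum degree. Adding all edges that keep the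
  components of \<open>G - S\<close> (merged down to \<open>r\<close> blocks) and the neighbourhood of \<open>v\<close> can only increase the
  spectral radius, so one may assume that \<open>G\<close> is a dominating clique joined to \<open>r\<close> cliques,
  except for the single vertex \<open>v\<close>. If \<open>v\<close> lies in \<open>S\<close>, a vertex of a block is promoted to \<open>S\<close> and
  \<open>v\<close> takes its place, at a strict gain.

  If \<open>v\<close> lies in a block, every graph of this shape other than the extremal one can be strictly
  improved within the family: by Kelmans moves shifting the neighbours of \<open>v\<close> into the dominating
  clique, by moving a vertex between two blocks towards the one of larger Perron weight, or, when
  the only large block is the one containing \<open>v\<close>, by exchanging \<open>v\<close> with a vertex \<open>x\<close> of another
  block (if \<open>v\<close> has the smaller Perron entry) or by letting \<open>x\<close> take over the role of the
  low-degree vertex (otherwise). As there are finitely many graphs, the process ends at the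
  extremal one. For \<open>\<delta> \<ge> k + h\<close> no special vertex is needed, because the minimum degree already
  forces all blocks to have at least \<open>\<delta> - k + 1\<close> vertices.
\<close>

section \<open>Variational characterisation of the spectral radius\<close>

definition nbrs :: "nat \<Rightarrow> (nat \<Rightarrow> nat \<Rightarrow> bool) \<Rightarrow> nat \<Rightarrow> nat set" where
  "nbrs n E i = {j. j < n \<and> E i j}"

text \<open>The quadratic form f^T A f of the adjacency matrix; only the values of \<open>f\<close>
  below \<open>n\<close> enter. Vectors are plain functions, so no carrier conditions arise.\<close>

definition qform :: "nat \<Rightarrow> (nat \<Rightarrow> nat \<Rightarrow> bool) \<Rightarrow> (nat \<Rightarrow> real) \<Rightarrow> real" where
  "qform n E f = (\<Sum>i<n. f i * sum f (nbrs n E i))"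

definition adj_eigvec :: "nat \<Rightarrow> (nat \<Rightarrow> nat \<Rightarrow> bool) \<Rightarrow> real \<Rightarrow> (nat \<Rightarrow> real) \<Rightarrow> bool" where
  "adj_eigvec n E x f \<longleftrightarrow> (\<exists>i<n. f i \<noteq> 0) \<and> (\<forall>i<n. sum f (nbrs n E i) = x * f i)"

lemma finite_nbrs [simp]: "finite (nbrs n E i)"
  by (simp add: nbrs_def)

lemma sum_nbrs_if: "sum f (nbrs n E i) = (\<Sum>j<n. if E i j then f j else 0 :: real)"
proof -
  have "nbrs n E i = {j \<in> {..<n}. E i j}"
    by (auto simp: nbrs_def)
  then show ?thesis
    using sum.inter_filter[of "{..<n}" f "E i"] by simp
qed

lemma eigenvalue_adj_mat_iff:
  "eigenvalue (adj_mat n E) x \<longleftrightarrow> (\<exists>f. adj_eigvec n E x f)"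
proof
  assume "eigenvalue (adj_mat n E) x"
  then obtain u where u: "u \<in> carrier_vec n" "u \<noteq> 0\<^sub>v n" "adj_mat n E *\<^sub>v u = x \<cdot>\<^sub>v u"
    by (auto simp: eigenvalue_def eigenvector_def adj_mat_def)
  have "\<exists>i<n. u $ i \<noteq> 0"
    using u(1,2) by (metis carrier_vecD eq_vecI index_zero_vec(1) index_zero_vec(2))
  moreover have "sum (\<lambda>j. u $ j) (nbrs n E i) = x * u $ i" if "i < n" for i
  proof -
    have "(adj_mat n E *\<^sub>v u) $ i = (\<Sum>j<n. if E i j then u $ j else 0)"
      using that u(1) by (auto simp: adj_mat_def scalar_prod_def atLeast0LessThan intro!: sum.cong)
    then show ?thesis
      using u that by (simp add: sum_nbrs_if)
  qed
  ultimately show "\<exists>f. adj_eigvec n E x f"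
    unfolding adj_eigvec_def by blast
next
  assume "\<exists>f. adj_eigvec n E x f"
  then obtain f where f: "adj_eigvec n E x f" ..
  have "adj_mat n E *\<^sub>v vec n f = x \<cdot>\<^sub>v vec n f"
  proof (rule eq_vecI)
    fix i assume "i < dim_vec (x \<cdot>\<^sub>v vec n f)"
    then have i: "i < n" by simp
    have "(adj_mat n E *\<^sub>v vec n f) $ i = (\<Sum>j<n. if E i j then f j else 0)"
      using i by (auto simp: adj_mat_def scalar_prod_def atLeast0LessThan intro!: sum.cong)
    then show "(adj_mat n E *\<^sub>v vec n f) $ i = (x \<cdot>\<^sub>v vec n f) $ i"
      using f i by (simp add: adj_eigvec_def sum_nbrs_if)
  qed (simp add: adj_mat_def)
  moreover have "vec n f \<noteq> 0\<^sub>v n"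
    using f unfolding adj_eigvec_def by (metis index_vec index_zero_vec(1))
  ultimately have "eigenvector (adj_mat n E) (vec n f) x"
    by (simp add: eigenvector_def adj_mat_def)
  then show "eigenvalue (adj_mat n E) x"
    unfolding eigenvalue_def by blast
qed

text \<open>Eigenvalues are roots of the monic characteristic polynomial. Finiteness gives meaning
  to the \<open>Max\<close> in \<open>spec_rad\<close>.\<close>

lemma finite_adj_eigenvalues: "finite {x. eigenvalue (adj_mat n E) x}"
proof -
  have A: "adj_mat n E \<in> carrier_mat n n"
    by (simp add: adj_mat_def)
  have "char_poly (adj_mat n E) \<noteq> 0"
    using degree_monic_char_poly[OF A] by auto
  then show ?thesis
    using eigenvalue_root_char_poly[OF A] poly_roots_finite by auto
qed

lemma adj_sum_symmetric:
  fixes f g :: "nat \<Rightarrow> real"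
  assumes "simple_graph n E"
  shows "(\<Sum>i<n. g i * sum f (nbrs n E i)) = (\<Sum>i<n. f i * sum g (nbrs n E i))"
proof -
  have "(\<Sum>i<n. g i * sum f (nbrs n E i)) = (\<Sum>i<n. \<Sum>j<n. if E i j then g i * f j else 0)"
    by (simp add: sum_nbrs_if sum_distrib_left if_distrib[of "\<lambda>z. _ * z"] cong: if_cong)
  also have "\<dots> = (\<Sum>j<n. \<Sum>i<n. if E i j then g i * f j else 0)"
    by (rule sum.swap)
  also have "\<dots> = (\<Sum>j<n. \<Sum>i<n. if E j i then f j * g i else 0)"
    using assms unfolding simple_graph_def by (intro sum.cong refl) (metis mult.commute)
  also have "\<dots> = (\<Sum>i<n. f i * sum g (nbrs n E i))"
    by (simp add: sum_nbrs_if sum_distrib_left if_distrib[of "\<lambda>z. _ * z"] cong: if_cong)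
  finally show ?thesis .
qed

lemma qform_add:
  assumes "simple_graph n E"
  shows "qform n E (\<lambda>i. f i + g i) = qform n E f + 2 * (\<Sum>i<n. g i * sum f (nbrs n E i)) + qform n E g"
  using adj_sum_symmetric[OF assms, of f g]
  by (simp add: qform_def sum.distrib distrib_left distrib_right)

lemma qform_mult: "qform n E (\<lambda>i. c * f i) = c\<^sup>2 * qform n E f"
  by (simp add: qform_def sum_distrib_left power2_eq_square mult_ac)

lemma qform_eigvec:
  assumes "\<And>i. i < n \<Longrightarrow> sum f (nbrs n E i) = x * f i"
  shows "qform n E f = x * (\<Sum>i<n. (f i)\<^sup>2)"
  using assms by (simp add: qform_def sum_distrib_left power2_eq_square mult_ac)

text \<open>First-order condition in one coordinate: replacing \<open>f i\<close> by
  \<open>f i + t\<close> changes the form by a term linear in \<open>t\<close>, since there are no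
  loops. Maximality then bounds \<open>2 * t * d\<close> by x t^2, where \<open>d\<close> is the
  defect of row \<open>i\<close>.\<close>

lemma maximizer_is_eigvec:
  assumes E: "simple_graph n E"
    and le: "\<And>g. qform n E g \<le> x * (\<Sum>i<n. (g i)\<^sup>2)"
    and eq: "qform n E f = x * (\<Sum>i<n. (f i)\<^sup>2)"
    and i: "i < n"
  shows "sum f (nbrs n E i) = x * f i"
proof -
  define d where "d = sum f (nbrs n E i) - x * f i"
  define e where "e t j = (if j = i then t else 0 :: real)" for t j
  have sum_e: "(\<Sum>j<n. e t j * a j) = t * a i" for t and a :: "nat \<Rightarrow> real"
    using i by (simp add: e_def if_distrib[of "\<lambda>z. z * _"] cong: if_cong)
  have "\<not> E i i"
    using E by (auto simp: simple_graph_def)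
  then have "sum (e t) (nbrs n E i) = 0" for t
    by (intro sum.neutral) (auto simp: nbrs_def e_def)
  then have qe: "qform n E (e t) = 0" for t
    unfolding qform_def by (simp add: sum_e)
  have bound: "2 * t * d \<le> x * t\<^sup>2" for t
  proof -
    have "qform n E f + 2 * (t * sum f (nbrs n E i)) \<le> x * (\<Sum>j<n. (f j + e t j)\<^sup>2)"
      using le[of "\<lambda>j. f j + e t j"] by (simp add: qform_add[OF E] sum_e qe)
    also have "(\<Sum>j<n. (f j + e t j)\<^sup>2) = (\<Sum>j<n. (f j)\<^sup>2 + e t j * (2 * f j + e t j))"
      by (simp add: power2_eq_square algebra_simps)
    also have "\<dots> = (\<Sum>j<n. (f j)\<^sup>2) + t * (2 * f i + t)"
      by (simp add: sum.distrib sum_e) (simp add: e_def)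
    finally show ?thesis
      using eq by (simp add: d_def algebra_simps power2_eq_square)
  qed
  \<comment> \<open>\<open>x\<close> may be zero or negative, so a positive upper bound
    \<open>y\<close> is used; \<open>t = d / y\<close> turns the bound into 2 d^2 / y <= d^2 /
    y.\<close>
  define y where "y = \<bar>x\<bar> + 1"
  have y: "y > 0" "x \<le> y"
    by (auto simp: y_def)
  have "2 * (d / y) * d \<le> x * (d / y)\<^sup>2"
    by (rule bound)
  also have "\<dots> \<le> y * (d / y)\<^sup>2"
    using y by (intro mult_right_mono) auto
  also have "\<dots> = (d / y) * d"
    using y by (simp add: power2_eq_square)
  finally have "d\<^sup>2 / y \<le> 0"
    by (simp add: power2_eq_square)
  then have "d\<^sup>2 \<le> 0"
    using y by (simp add: divide_le_0_iff)
  then show ?thesis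
    by (simp add: d_def)
qed

text \<open>Compactness of the unit sphere gives a maximiser there; scaling extends the bound to all
  \<open>g\<close>.\<close>

lemma qform_maximizer_exists:
  assumes "n > 0"
  shows "\<exists>f. (\<Sum>i<n. (f i)\<^sup>2) = 1 \<and> (\<forall>g. qform n E g \<le> qform n E f * (\<Sum>i<n. (g i)\<^sup>2))"
proof -
  \<comment> \<open>Freezing the coordinates from \<open>n\<close> on at 0 embeds the cube into the
    function space as a product of compact sets, compact by Tychonoff's theorem.\<close>
  define K where "K = (Pi\<^sub>E UNIV (\<lambda>i. if i < n then {-1..1} else {0 :: real}))"
  define L where "L = K \<inter> {f. (\<Sum>i<n. (f i)\<^sup>2) = 1}"
  have cont: "continuous_on UNIV (\<lambda>f :: nat \<Rightarrow> real. f i)" for i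
    by (rule continuous_on_product_coordinates)
  have "compactin euclidean K"
    unfolding K_def euclidean_product_topology[symmetric] compactin_PiE by auto
  then have "compact K"
    by simp
  moreover have "closed {f :: nat \<Rightarrow> real. (\<Sum>i<n. (f i)\<^sup>2) = 1}"
    by (intro closed_Collect_eq continuous_intros cont)
  ultimately have "compact L"
    by (simp add: L_def compact_Int_closed)
  moreover have "(\<lambda>i. if i = 0 then 1 else 0) \<in> L"
    using assms by (auto simp: L_def K_def if_distrib[of "\<lambda>z. z\<^sup>2"] cong: if_cong)
  then have "L \<noteq> {}" by auto
  moreover have "continuous_on L (qform n E)"
    unfolding qform_def
    by (intro continuous_intros continuous_on_subset[OF cont]) auto
  ultimately obtain f where f: "f \<in> L" "\<And>g. g \<in> L \<Longrightarrow> qform n E g \<le> qform n E f"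
    using continuous_attains_sup by metis
  have "qform n E g \<le> qform n E f * (\<Sum>i<n. (g i)\<^sup>2)" for g
  proof (cases "(\<Sum>i<n. (g i)\<^sup>2) = 0")
    case True
    then have "g i = 0" if "i < n" for i
      using that by (simp add: sum_nonneg_eq_0_iff)
    then show ?thesis
      using True by (simp add: qform_def)
  next
    case False
    define s where "s = sqrt (\<Sum>i<n. (g i)\<^sup>2)"
    have s2: "s\<^sup>2 = (\<Sum>i<n. (g i)\<^sup>2)"
      by (simp add: s_def sum_nonneg)
    have s: "s > 0"
      using False by (simp add: s_def sum_nonneg order_le_neq_trans)
    \<comment> \<open>Cut off at \<open>n\<close> so as to land in \<open>K\<close>; the form is
      unaffected by this.\<close>
    define g' where "g' i = (if i < n then inverse s * g i else 0)" for i
    have unit: "(\<Sum>i<n. (g' i)\<^sup>2) = 1"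
    proof -
      have "(\<Sum>i<n. (g' i)\<^sup>2) = (inverse s)\<^sup>2 * s\<^sup>2"
        unfolding s2 by (simp add: g'_def power_mult_distrib sum_distrib_left)
      then show ?thesis
        using s by (simp add: field_simps)
    qed
    have "(g' i)\<^sup>2 \<le> 1" if "i < n" for i
      using member_le_sum[of i "{..<n}" "\<lambda>i. (g' i)\<^sup>2"] that unit by simp
    then have "g' i \<in> (if i < n then {-1..1} else {0})" for i
      by (auto simp: abs_square_le_1 abs_le_iff) (auto simp: g'_def)
    then have "g' \<in> L"
      using unit by (auto simp: L_def K_def)
    then have "qform n E g' \<le> qform n E f"
      by (rule f)
    moreover have "qform n E g' = qform n E (\<lambda>i. inverse s * g i)"
      unfolding qform_def g'_def
      by (intro sum.cong refl arg_cong2[of _ _ _ _ "(*)"]) (auto simp: nbrs_def)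
    ultimately have "(inverse s)\<^sup>2 * qform n E g \<le> qform n E f"
      by (simp only: qform_mult)
    then show ?thesis
      using s unfolding s2[symmetric] by (simp add: field_simps)
  qed
  then show ?thesis
    using f(1) by (auto simp: L_def)
qed

text \<open>Rayleigh principle. Taking absolute values cannot lower the form, so a nonnegative
  maximiser exists and is an eigenvector. Every eigenvalue is the Rayleigh quotient of its own
  eigenvector, hence at most the maximum.\<close>

lemma spec_rad_variational:
  assumes n: "n > 0" and E: "simple_graph n E"
  shows spec_rad_upper: "qform n E g \<le> spec_rad n E * (\<Sum>i<n. (g i)\<^sup>2)"
    and spec_rad_nonneg_eigvec: "\<exists>f. (\<forall>i<n. 0 \<le> f i) \<and> adj_eigvec n E (spec_rad n E) f"
proof -
  obtain f0 where f0: "(\<Sum>i<n. (f0 i)\<^sup>2) = 1"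
      "\<And>g. qform n E g \<le> qform n E f0 * (\<Sum>i<n. (g i)\<^sup>2)"
    using qform_maximizer_exists[OF n] by metis
  define x where "x = qform n E f0"
  define f where "f i = \<bar>f0 i\<bar>" for i
  have f1: "(\<Sum>i<n. (f i)\<^sup>2) = 1"
    using f0(1) by (simp add: f_def)
  have "f0 i * sum f0 (nbrs n E i) \<le> f i * sum f (nbrs n E i)" for i
  proof -
    have "f0 i * sum f0 (nbrs n E i) \<le> \<bar>f0 i\<bar> * \<bar>sum f0 (nbrs n E i)\<bar>"
      by (metis abs_ge_self abs_mult)
    also have "\<dots> \<le> f i * sum f (nbrs n E i)"
      unfolding f_def by (intro mult_left_mono sum_abs) auto
    finally show ?thesis .
  qed
  then have "x \<le> qform n E f"
    unfolding x_def qform_def by (intro sum_mono) auto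
  then have "qform n E f = x * (\<Sum>i<n. (f i)\<^sup>2)"
    using f0(2)[of f] f1 by (simp add: x_def)
  then have eig: "sum f (nbrs n E i) = x * f i" if "i < n" for i
    using maximizer_is_eigvec[OF E _ _ that] f0(2) unfolding x_def by blast
  have "\<exists>i<n. f i \<noteq> 0"
  proof (rule ccontr)
    assume "\<not> (\<exists>i<n. f i \<noteq> 0)"
    then have "(\<Sum>i<n. (f i)\<^sup>2) = 0"
      by (intro sum.neutral) auto
    then show False
      using f1 by simp
  qed
  then have vec: "adj_eigvec n E x f"
    using eig by (simp add: adj_eigvec_def)
  have "y \<le> x" if y: "eigenvalue (adj_mat n E) y" for y
  proof -
    obtain g where g: "adj_eigvec n E y g"
      using y eigenvalue_adj_mat_iff by blast
    have "y * (\<Sum>i<n. (g i)\<^sup>2) = qform n E g"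
      using g by (intro qform_eigvec[symmetric]) (simp add: adj_eigvec_def)
    also have "\<dots> \<le> x * (\<Sum>i<n. (g i)\<^sup>2)"
      unfolding x_def by (rule f0)
    finally have "y * (\<Sum>i<n. (g i)\<^sup>2) \<le> x * (\<Sum>i<n. (g i)\<^sup>2)" .
    moreover obtain i where "i < n" "g i \<noteq> 0"
      using g by (auto simp: adj_eigvec_def)
    then have "(\<Sum>i<n. (g i)\<^sup>2) > 0"
      by (intro sum_pos2[of _ i]) auto
    ultimately show ?thesis
      by simp
  qed
  then have x: "spec_rad n E = x"
    unfolding spec_rad_def using vec eigenvalue_adj_mat_iff finite_adj_eigenvalues
    by (intro Max_eqI) blast+
  show "qform n E g \<le> spec_rad n E * (\<Sum>i<n. (g i)\<^sup>2)"
    unfolding x unfolding x_def by (rule f0)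
  show "\<exists>f. (\<forall>i<n. 0 \<le> f i) \<and> adj_eigvec n E (spec_rad n E) f"
    using vec unfolding x by (intro exI[of _ f]) (simp add: f_def)
qed

section \<open>Comparing spectral radii\<close>

lemma graph_iso_sym:
  assumes "graph_iso n E F"
  shows "graph_iso n F E"
proof -
  obtain p where p: "bij_betw p {0..<n} {0..<n}"
      "\<And>u v. u \<in> {0..<n} \<Longrightarrow> v \<in> {0..<n} \<Longrightarrow> E u v \<longleftrightarrow> F (p u) (p v)"
    using assms unfolding graph_iso_def by blast
  let ?q = "inv_into {0..<n} p"
  have "bij_betw ?q {0..<n} {0..<n}"
    using p(1) by (rule bij_betw_inv_into)
  moreover have "F u v \<longleftrightarrow> E (?q u) (?q v)" if "u \<in> {0..<n}" "v \<in> {0..<n}" for u v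
    using p that by (metis bij_betw_imp_surj_on f_inv_into_f inv_into_into)
  ultimately show ?thesis
    unfolding graph_iso_def by blast
qed

lemma adj_eigvec_graph_iso:
  assumes p: "bij_betw p {0..<n} {0..<n}"
    and iso: "\<And>u v. u \<in> {0..<n} \<Longrightarrow> v \<in> {0..<n} \<Longrightarrow> E u v \<longleftrightarrow> F (p u) (p v)"
    and f: "adj_eigvec n F x f"
  shows "adj_eigvec n E x (f \<circ> p)"
proof -
  have lt: "p i < n" if "i < n" for i
    using p that by (auto simp: bij_betw_def)
  have rows: "sum (f \<circ> p) (nbrs n E i) = x * (f \<circ> p) i" if "i < n" for i
  proof -
    have "nbrs n F (p i) = p ` nbrs n E i"
    proof
      show "nbrs n F (p i) \<subseteq> p ` nbrs n E i"
      proof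
        fix w assume w: "w \<in> nbrs n F (p i)"
        then obtain j where j: "j < n" "w = p j"
          using p unfolding bij_betw_def nbrs_def by force
        then show "w \<in> p ` nbrs n E i"
          using w that by (auto simp: nbrs_def iso)
      qed
      show "p ` nbrs n E i \<subseteq> nbrs n F (p i)"
        using that lt by (auto simp: nbrs_def iso)
    qed
    moreover have "inj_on p (nbrs n E i)"
      using p by (auto simp: bij_betw_def nbrs_def intro: inj_on_subset)
    ultimately have "sum (f \<circ> p) (nbrs n E i) = sum f (nbrs n F (p i))"
      by (simp add: sum.reindex)
    then show ?thesis
      using f lt[OF that] by (simp add: adj_eigvec_def)
  qed
  obtain j where "j < n" "f j \<noteq> 0"
    using f by (auto simp: adj_eigvec_def)
  moreover obtain i where "i < n" "j = p i"
    using p \<open>j < n\<close> unfolding bij_betw_def by (metis atLeast0LessThan image_iff lessThan_iff)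
  ultimately have "\<exists>i<n. (f \<circ> p) i \<noteq> 0"
    by auto
  with rows show ?thesis
    by (simp add: adj_eigvec_def)
qed

lemma spec_rad_graph_iso:
  assumes "graph_iso n E F"
  shows "spec_rad n E = spec_rad n F"
proof -
  have "eigenvalue (adj_mat n E) x" if "graph_iso n E F" "eigenvalue (adj_mat n F) x" for E F x
    using that unfolding eigenvalue_adj_mat_iff graph_iso_def
    by (metis adj_eigvec_graph_iso)
  then have "eigenvalue (adj_mat n E) x \<longleftrightarrow> eigenvalue (adj_mat n F) x" for x
    using assms graph_iso_sym by blast
  then show ?thesis
    by (simp add: spec_rad_def)
qed

section \<open>Change of the quadratic form under edits at one or two vertices\<close>

text \<open>Each edge at \<open>x\<close> is counted in row \<open>x\<close> and, by symmetry, once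
  more in the row of its other end; hence the factor 2.\<close>

lemma qform_one_vertex_change:
  assumes H: "simple_graph n H" and T: "simple_graph n T" and x: "x < n"
    and same: "\<And>i j. i \<noteq> x \<Longrightarrow> j \<noteq> x \<Longrightarrow> T i j \<longleftrightarrow> H i j"
  shows "qform n T f - qform n H f = 2 * f x * (sum f (nbrs n T x) - sum f (nbrs n H x))"
proof -
  define D where "D i j = (if T i j then f j else 0) - (if H i j then f j else 0)" for i j
  have row: "sum f (nbrs n T i) - sum f (nbrs n H i) = (\<Sum>j<n. D i j)" for i
    by (simp add: sum_nbrs_if D_def sum_subtractf)
  have xx: "D x x = 0"
    using H T by (auto simp: D_def simple_graph_def)
  have off: "f i * (\<Sum>j<n. D i j) = f x * D x i" if "i < n" "i \<noteq> x" for i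
  proof -
    have "D i j = 0" if "j \<noteq> x" for j
      using same[OF \<open>i \<noteq> x\<close> that] by (simp add: D_def)
    then have "(\<Sum>j<n. D i j) = D i x"
      using x by (subst sum.remove[of _ x]) auto
    moreover have "T i x \<longleftrightarrow> T x i" "H i x \<longleftrightarrow> H x i"
      using H T by (auto simp: simple_graph_def)
    ultimately show ?thesis
      by (simp add: D_def)
  qed
  have "qform n T f - qform n H f = (\<Sum>i<n. f i * (\<Sum>j<n. D i j))"
    by (simp add: qform_def row[symmetric] right_diff_distrib sum_subtractf)
  also have "\<dots> = f x * (\<Sum>j<n. D x j) + (\<Sum>i\<in>{..<n} - {x}. f x * D x i)"
    using x by (subst sum.remove[of _ x]) (auto simp: off)
  also have "(\<Sum>i\<in>{..<n} - {x}. f x * D x i) = f x * (\<Sum>i<n. D x i)"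
    using x xx by (simp add: sum_distrib_left[symmetric] sum.remove[of "{..<n}" x])
  finally show ?thesis
    by (simp add: row)
qed

text \<open>Two successive one-vertex changes, first at \<open>x\<close>, then at \<open>y\<close>.
  Agreement on the pair \<open>x\<close>, \<open>y\<close> keeps row \<open>y\<close> intact during
  the first one.\<close>

lemma qform_two_vertex_change:
  assumes H: "simple_graph n H" and T: "simple_graph n T" and x: "x < n" and y: "y < n" and "x \<noteq> y"
    and same: "\<And>i j. i \<noteq> x \<Longrightarrow> j \<noteq> x \<Longrightarrow> i \<noteq> y \<Longrightarrow> j \<noteq> y \<Longrightarrow> T i j \<longleftrightarrow> H i j"
    and xy: "T x y \<longleftrightarrow> H x y"
  shows "qform n T f - qform n H f =
    2 * f x * (sum f (nbrs n T x) - sum f (nbrs n H x)) + 2 * f y * (sum f (nbrs n T y) - sum f (nbrs n H y))"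
proof -
  define M where "M i j = (if i = x \<or> j = x then T i j else H i j)" for i j
  have M: "simple_graph n M"
    using H T by (auto simp: M_def simple_graph_def)
  have yx: "T y x \<longleftrightarrow> H y x"
    using xy H T by (auto simp: simple_graph_def)
  have "qform n M f - qform n H f = 2 * f x * (sum f (nbrs n M x) - sum f (nbrs n H x))"
    using H M x by (intro qform_one_vertex_change) (auto simp: M_def)
  moreover have "T i j \<longleftrightarrow> M i j" if "i \<noteq> y" "j \<noteq> y" for i j
    using that same by (auto simp: M_def)
  then have "qform n T f - qform n M f = 2 * f y * (sum f (nbrs n T y) - sum f (nbrs n M y))"
    using T M y by (intro qform_one_vertex_change) auto
  moreover have "nbrs n M x = nbrs n T x" "nbrs n M y = nbrs n H y"
    using yx \<open>x \<noteq> y\<close> by (auto simp: M_def nbrs_def)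
  ultimately show ?thesis
    by simp
qed

lemma qform_mono:
  assumes "\<And>i. i < n \<Longrightarrow> 0 \<le> f i" "\<And>i j. H i j \<Longrightarrow> T i j"
  shows "qform n H f \<le> qform n T f"
  unfolding qform_def using assms
  by (intro sum_mono mult_left_mono sum_mono2) (auto simp: nbrs_def)

text \<open>The target graph of every comparison has radius at most two; this stronger condition
  replaces connectivity in the Perron--Frobenius argument.\<close>

definition radius2 :: "nat \<Rightarrow> (nat \<Rightarrow> nat \<Rightarrow> bool) \<Rightarrow> bool" where
  "radius2 n E \<longleftrightarrow> (\<exists>d<n. \<forall>z<n. z \<noteq> d \<longrightarrow> E d z \<or> (\<exists>y. E d y \<and> E y z))"

text \<open>A zero of a nonnegative eigenvector forces zeros at all neighbours, because their sum
  vanishes. Through the centre \<open>d\<close> a single zero would spread to every vertex.\<close>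

lemma nonneg_eigvec_pos:
  assumes E: "simple_graph n E" and "radius2 n E"
    and f: "adj_eigvec n E x f" and nn: "\<And>i. i < n \<Longrightarrow> 0 \<le> f i" and "i < n"
  shows "0 < f i"
proof -
  have zero: "f j = 0" if "E i j" "f i = 0" for i j
  proof -
    have "i < n" "j \<in> nbrs n E i"
      using E that by (auto simp: simple_graph_def nbrs_def)
    moreover have "sum f (nbrs n E i) = 0"
      using f \<open>i < n\<close> \<open>f i = 0\<close> by (simp add: adj_eigvec_def)
    moreover have "0 \<le> f j" if "j \<in> nbrs n E i" for j
      using that nn by (simp add: nbrs_def)
    ultimately show ?thesis
      using sum_nonneg_eq_0_iff[of "nbrs n E i" f] by auto
  qed
  have sym: "E j i" if "E i j" for i j
    using that E by (auto simp: simple_graph_def)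
  obtain d where d: "d < n" "\<And>z. z < n \<Longrightarrow> z \<noteq> d \<Longrightarrow> E d z \<or> (\<exists>y. E d y \<and> E y z)"
    using assms(2) by (auto simp: radius2_def)
  obtain i0 where i0: "i0 < n" "f i0 \<noteq> 0"
    using f by (auto simp: adj_eigvec_def)
  have "f d \<noteq> 0"
    using d(2)[of i0] i0 zero by metis
  then have "f i \<noteq> 0"
    using d(2)[of i] \<open>i < n\<close> zero sym by metis
  then show ?thesis
    using nn[OF \<open>i < n\<close>] by simp
qed

lemma eigvec_norm_pos:
  assumes "adj_eigvec n E x f"
  shows "0 < (\<Sum>i<n. (f i)\<^sup>2)"
proof -
  obtain i where "i < n" "f i \<noteq> 0"
    using assms by (auto simp: adj_eigvec_def)
  then show ?thesis
    by (intro sum_pos2[of _ i]) auto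
qed

section \<open>Eigenvectors of one graph as test vectors for another\<close>

lemma spec_rad_less:
  assumes "simple_graph n T" and f: "adj_eigvec n H (spec_rad n H) f"
    and "qform n H f < qform n T f"
  shows "spec_rad n H < spec_rad n T"
proof -
  have "n > 0"
    using f by (auto simp: adj_eigvec_def)
  have "spec_rad n H * (\<Sum>i<n. (f i)\<^sup>2) = qform n H f"
    using f by (intro qform_eigvec[symmetric]) (simp add: adj_eigvec_def)
  also have "\<dots> < spec_rad n T * (\<Sum>i<n. (f i)\<^sup>2)"
    using assms(3) spec_rad_upper[OF \<open>n > 0\<close> assms(1), of f] by linarith
  finally show ?thesis
    using eigvec_norm_pos[OF f] by simp
qed

lemma spec_rad_pos_eigvec:
  assumes "simple_graph n E" "radius2 n E"
  obtains f where "adj_eigvec n E (spec_rad n E) f" "\<forall>i<n. 0 < f i"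
proof -
  have "n > 0"
    using assms(2) by (auto simp: radius2_def)
  then obtain f where "adj_eigvec n E (spec_rad n E) f" "\<forall>i<n. 0 \<le> f i"
    using spec_rad_nonneg_eigvec assms(1) by blast
  then show thesis
    using that nonneg_eigvec_pos[OF assms] by blast
qed

lemma spec_rad_mono:
  assumes n: "n > 0" and H: "simple_graph n H" and T: "simple_graph n T"
    and sub: "\<And>i j. H i j \<Longrightarrow> T i j"
  shows "spec_rad n H \<le> spec_rad n T"
proof -
  obtain f where f: "adj_eigvec n H (spec_rad n H) f" "\<forall>i<n. 0 \<le> f i"
    using spec_rad_nonneg_eigvec[OF n H] by blast
  have "spec_rad n H * (\<Sum>i<n. (f i)\<^sup>2) = qform n H f"
    using f by (intro qform_eigvec[symmetric]) (simp add: adj_eigvec_def)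
  also have "\<dots> \<le> qform n T f"
    using f(2) sub by (intro qform_mono) auto
  also have "\<dots> \<le> spec_rad n T * (\<Sum>i<n. (f i)\<^sup>2)"
    by (rule spec_rad_upper[OF n T])
  finally show ?thesis
    using eigvec_norm_pos[OF f(1)] by simp
qed

text \<open>In the equality case \<open>f\<close> attains the maximum for \<open>T\<close> as well,
  so it is an eigenvector of both graphs for the same value; this gives positivity and equal row
  sums.\<close>

lemma spec_rad_compare:
  assumes T: "simple_graph n T" "radius2 n T"
    and f: "adj_eigvec n H (spec_rad n H) f" "\<forall>i<n. 0 \<le> f i"
    and le: "qform n H f \<le> qform n T f"
  shows "spec_rad n H \<le> spec_rad n T"
    and "spec_rad n H = spec_rad n T \<Longrightarrow> i < n \<Longrightarrow> 0 < f i \<and> sum f (nbrs n T i) = sum f (nbrs n H i)"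
proof -
  have "n > 0"
    using f by (auto simp: adj_eigvec_def)
  note up = spec_rad_upper[OF \<open>n > 0\<close> T(1)]
  have eq: "qform n H f = spec_rad n H * (\<Sum>i<n. (f i)\<^sup>2)"
    using f by (intro qform_eigvec) (simp add: adj_eigvec_def)
  then have "spec_rad n H * (\<Sum>i<n. (f i)\<^sup>2) \<le> spec_rad n T * (\<Sum>i<n. (f i)\<^sup>2)"
    using le up[of f] by linarith
  then show "spec_rad n H \<le> spec_rad n T"
    using eigvec_norm_pos[OF f(1)] by simp
  assume same: "spec_rad n H = spec_rad n T" and i: "i < n"
  have "qform n T f = spec_rad n T * (\<Sum>i<n. (f i)\<^sup>2)"
    using le up[of f] eq same by simp
  then have row: "sum f (nbrs n T j) = spec_rad n T * f j" if "j < n" for j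
    using maximizer_is_eigvec[OF T(1) up _ that] by blast
  then have "adj_eigvec n T (spec_rad n T) f"
    using f(1) by (auto simp: adj_eigvec_def)
  then have "0 < f i"
    using nonneg_eigvec_pos T f(2) i by blast
  then show "0 < f i \<and> sum f (nbrs n T i) = sum f (nbrs n H i)"
    using row[OF i] f(1) i same by (simp add: adj_eigvec_def)
qed

text \<open>Source of strictness when the form is only known not to decrease: equal radii would make
  \<open>f\<close> positive with equal row sums, whereas a larger neighbourhood has a larger
  sum.\<close>

lemma spec_rad_less_of_row:
  assumes T: "simple_graph n T" "radius2 n T"
    and f: "adj_eigvec n H (spec_rad n H) f" "\<forall>i<n. 0 \<le> f i"
    and le: "qform n H f \<le> qform n T f"
    and i: "i < n" "nbrs n H i \<subset> nbrs n T i"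
  shows "spec_rad n H < spec_rad n T"
proof (rule ccontr)
  assume "\<not> spec_rad n H < spec_rad n T"
  then have eq: "spec_rad n H = spec_rad n T"
    using spec_rad_compare(1)[OF T f le] by simp
  note cmp = spec_rad_compare(2)[OF T f le eq]
  have "0 < f j" if "j \<in> nbrs n T i" for j
    using cmp[of j] that by (simp add: nbrs_def)
  moreover obtain j where "j \<in> nbrs n T i - nbrs n H i"
    using i(2) by blast
  ultimately have "sum f (nbrs n H i) < sum f (nbrs n T i)"
    using i(2) by (intro sum_strict_mono2[of _ _ j]) (auto intro: less_imp_le)
  then show False
    using cmp[OF i(1)] by simp
qed

text \<open>Strict monotonicity under adding edges, for the equality case of the theorem.\<close>

lemma spec_rad_subgraph_eq:
  assumes n: "n > 0" and H: "simple_graph n H" and T: "simple_graph n T" "radius2 n T"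
    and sub: "\<And>i j. H i j \<Longrightarrow> T i j"
    and eq: "spec_rad n H = spec_rad n T"
  shows "H = T"
proof -
  obtain f where f: "adj_eigvec n H (spec_rad n H) f" "\<forall>i<n. 0 \<le> f i"
    using spec_rad_nonneg_eigvec[OF n H] by blast
  have le: "qform n H f \<le> qform n T f"
    using f(2) sub by (intro qform_mono) auto
  have "H i j" if "T i j" for i j
  proof (rule ccontr)
    assume "\<not> H i j"
    moreover have "i < n" "j < n"
      using T that by (auto simp: simple_graph_def)
    ultimately have "nbrs n H i \<subset> nbrs n T i"
      using that sub by (auto simp: nbrs_def)
    then show False
      using spec_rad_less_of_row[OF T f le \<open>i < n\<close>] eq by simp
  qed
  then show "H = T"
    using sub by blast
qed

text \<open>\<open>kelmans_le H u w T\<close>: the graph \<open>T\<close> contains the Kelmans transform of \<open>H\<close> that redirects the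
  private neighbours of \<open>u\<close> to \<open>w\<close>. Transforming in the opposite direction yields an isomorphic
  graph, so the spectral radius does not decrease whichever of \<open>u\<close>, \<open>w\<close> has the larger
  Perron entry.\<close>

definition kelmans_le :: "(nat \<Rightarrow> nat \<Rightarrow> bool) \<Rightarrow> nat \<Rightarrow> nat \<Rightarrow> (nat \<Rightarrow> nat \<Rightarrow> bool) \<Rightarrow> bool" where
  "kelmans_le H u w T \<longleftrightarrow>
     (\<forall>i j. i \<notin> {u, w} \<and> j \<notin> {u, w} \<and> H i j \<longrightarrow> T i j) \<and>
     (\<forall>z. z \<notin> {u, w} \<and> (H w z \<or> H u z) \<longrightarrow> T w z) \<and>
     (\<forall>z. z \<notin> {u, w} \<and> H w z \<and> H u z \<longrightarrow> T u z) \<and> (H u w \<longrightarrow> T u w)"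

text \<open>At \<open>w\<close> the gain is at least the weight of \<open>P\<close>, the private
  neighbours of \<open>u\<close>; at \<open>u\<close> the loss is at most that weight. As
  \<open>f u <= f w\<close>, the form does not drop, and the new neighbour \<open>z\<close> of
  \<open>w\<close> makes the inequality strict.\<close>

lemma spec_rad_kelmans_directed:
  assumes H: "simple_graph n H" and T: "simple_graph n T" "radius2 n T"
    and uw: "u < n" "w < n" "u \<noteq> w" and K: "kelmans_le H u w T"
    and f: "adj_eigvec n H (spec_rad n H) f" "\<forall>i<n. 0 \<le> f i" and fuw: "f u \<le> f w"
    and new: "z \<notin> {u, w}" "T w z" "\<not> H w z"
  shows "spec_rad n H < spec_rad n T"
proof -
  have irr: "\<not> H i i" "\<not> T i i" and Hsym: "H i j \<longleftrightarrow> H j i" and Tsym: "T i j \<longleftrightarrow> T j i" for i j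
    using H T(1) by (auto simp: simple_graph_def)
  \<comment> \<open>\<open>M\<close> differs from \<open>H\<close> only in edges joining
    \<open>u\<close> or \<open>w\<close> to the remaining vertices, as the two-vertex formula
    requires, and it is contained in \<open>T\<close>.\<close>
  define M where "M i j = (if {i, j} = {u, w} then H i j else if i \<in> {u, w} \<or> j \<in> {u, w} then T i j else H i j)" for i j
  have M: "simple_graph n M"
    using H T(1) unfolding M_def simple_graph_def by (auto simp: doubleton_eq_iff)
  define P where "P = {z. z < n \<and> z \<notin> {u, w} \<and> H u z \<and> \<not> H w z}"
  have MT: "M i j \<Longrightarrow> T i j" for i j
    using K uw irr Hsym Tsym unfolding M_def kelmans_le_def by (auto simp: doubleton_eq_iff split: if_splits)
  have "sum f (nbrs n H w) + sum f P = sum f (nbrs n H w \<union> P)"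
    by (rule sum.union_disjoint[symmetric]) (auto simp: nbrs_def P_def)
  also have "\<dots> \<le> sum f (nbrs n M w)"
    using uw K Hsym Tsym irr f(2)
    by (intro sum_mono2) (auto simp: nbrs_def P_def M_def kelmans_le_def doubleton_eq_iff)
  finally have w: "sum f P \<le> sum f (nbrs n M w) - sum f (nbrs n H w)"
    by simp
  have "T u j" if "H u j" "H w j" for j
  proof -
    have "j \<notin> {u, w}"
      using that irr by auto
    then show ?thesis
      using K that unfolding kelmans_le_def by blast
  qed
  then have "sum f (nbrs n H u) \<le> sum f (nbrs n M u \<union> P)"
    using uw irr f(2) by (intro sum_mono2) (auto simp: nbrs_def P_def M_def doubleton_eq_iff)
  also have "\<dots> \<le> sum f (nbrs n M u) + sum f P"
    using f(2) by (subst sum_Un) (auto simp: P_def nbrs_def intro!: sum_nonneg)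
  finally have u: "- sum f P \<le> sum f (nbrs n M u) - sum f (nbrs n H u)"
    by simp
  have "0 \<le> 2 * (f w - f u) * sum f P"
    using fuw f(2) by (intro mult_nonneg_nonneg sum_nonneg) (auto simp: P_def)
  also have "\<dots> = 2 * f w * sum f P + 2 * f u * (- sum f P)"
    by (simp add: algebra_simps)
  also have "\<dots> \<le> 2 * f w * (sum f (nbrs n M w) - sum f (nbrs n H w))
      + 2 * f u * (sum f (nbrs n M u) - sum f (nbrs n H u))"
    using w u f(2) uw by (intro add_mono mult_left_mono) auto
  also have "\<dots> = qform n M f - qform n H f"
    using uw(3) by (intro qform_two_vertex_change[OF H M uw(2,1), symmetric]) (auto simp: M_def)
  finally have "qform n H f \<le> qform n M f"
    by simp
  also have "\<dots> \<le> qform n T f"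
    using f(2) MT by (intro qform_mono) auto
  finally have le: "qform n H f \<le> qform n T f" .
  have "H w j \<longrightarrow> T w j" for j
    using K irr Hsym Tsym by (cases "j = u"; cases "j = w") (auto simp: kelmans_le_def)
  moreover have "z < n"
    using T new by (auto simp: simple_graph_def)
  ultimately have "nbrs n H w \<subset> nbrs n T w"
    using new by (auto simp: nbrs_def)
  then show ?thesis
    by (rule spec_rad_less_of_row[OF T f le uw(2)])
qed

text \<open>If \<open>u\<close> has the larger Perron entry, \<open>T\<close> is read with
  \<open>u\<close> and \<open>w\<close> exchanged, which preserves its radius. Each direction has
  its own witness of strictness: \<open>z\<close> for \<open>w\<close> and \<open>z'\<close> for
  \<open>u\<close>.\<close>

lemma spec_rad_kelmans:
  assumes n: "n > 0" and H: "simple_graph n H" and T: "simple_graph n T" "radius2 n T"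
    and uw: "u < n" "w < n" "u \<noteq> w" and K: "kelmans_le H u w T"
    and new: "z \<notin> {u, w}" "T w z" "\<not> H w z"
    and new': "z' \<notin> {u, w}" "T w z'" "\<not> H u z'"
  shows "spec_rad n H < spec_rad n T"
proof -
  obtain f where f: "adj_eigvec n H (spec_rad n H) f" "\<forall>i<n. 0 \<le> f i"
    using spec_rad_nonneg_eigvec[OF n H] by blast
  show ?thesis
  proof (cases "f u \<le> f w")
    case True
    then show ?thesis
      using spec_rad_kelmans_directed[OF H T uw K f _ new] by simp
  next
    case False
    define s where "s = Transposition.transpose u w"
    define T' where "T' i j = T (s i) (s j)" for i j
    have s_lt: "s i < n \<longleftrightarrow> i < n" for i
      using uw by (auto simp: s_def Transposition.transpose_def)
    have s_inv: "s (s i) = i" for i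
      by (simp add: s_def)
    have T': "simple_graph n T'"
      using T(1) unfolding simple_graph_def T'_def by (metis s_lt)
    have rad: "radius2 n T'"
      using T(2) unfolding radius2_def T'_def by (metis s_lt s_inv)
    have "bij_betw s {0..<n} {0..<n}"
      by (rule bij_betw_byWitness[where f' = s]) (auto simp: s_inv s_lt)
    then have "graph_iso n T' T"
      unfolding graph_iso_def T'_def by blast
    then have same: "spec_rad n T' = spec_rad n T"
      by (rule spec_rad_graph_iso)
    have s: "s u = w" "s w = u" "\<And>i. i \<noteq> u \<Longrightarrow> i \<noteq> w \<Longrightarrow> s i = i"
      by (auto simp: s_def)
    have sym: "H u w \<longleftrightarrow> H w u" "T u w \<longleftrightarrow> T w u"
      using H T(1) by (auto simp: simple_graph_def)
    have "kelmans_le H w u T'"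
      using K uw sym unfolding kelmans_le_def T'_def by (auto simp: s)
    then show ?thesis
      using spec_rad_kelmans_directed[OF H T' rad uw(2) uw(1) _ _ f, of z'] False new' uw same
      by (auto simp: T'_def s)
  qed
qed

section \<open>Block graphs\<close>

text \<open>The label \<open>c\<close> is \<open>0\<close> on the dominating clique and numbers the blocks from \<open>1\<close>; the special
  vertex \<open>v\<close> has the prescribed neighbourhood \<open>N\<close>. Taking \<open>v = n\<close> (not a vertex) and \<open>N = {}\<close> gives
  the join of a clique with a disjoint union of cliques.\<close>

definition block_graph :: "nat \<Rightarrow> (nat \<Rightarrow> nat) \<Rightarrow> nat \<Rightarrow> nat set \<Rightarrow> nat \<Rightarrow> nat \<Rightarrow> bool" where
  "block_graph n c v N a b \<longleftrightarrow> a < n \<and> b < n \<and> a \<noteq> b \<and>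
     (if a = v then b \<in> N else if b = v then a \<in> N else c a = 0 \<or> c b = 0 \<or> c a = c b)"

definition cls :: "nat \<Rightarrow> (nat \<Rightarrow> nat) \<Rightarrow> nat \<Rightarrow> nat set" where
  "cls n c i = {z. z < n \<and> c z = i}"

text \<open>Removing \<open>v\<close> keeps the row formulas uniform, because the adjacency of
  \<open>v\<close> is governed by \<open>N\<close> and not by its label.\<close>

definition part :: "nat \<Rightarrow> (nat \<Rightarrow> nat) \<Rightarrow> nat \<Rightarrow> nat \<Rightarrow> nat set" where
  "part n c v i = cls n c i - {v}"

lemma finite_cls [simp]: "finite (cls n c i)"
  by (simp add: cls_def)

lemma finite_part [simp]: "finite (part n c v i)"
  by (simp add: part_def)

lemma simple_graph_block_graph: "simple_graph n (block_graph n c v N)"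
  by (auto simp: simple_graph_def block_graph_def)

text \<open>The centre is a vertex \<open>d\<close> of the dominating clique; it reaches
  \<open>v\<close> directly or through a member of \<open>N\<close>.\<close>

lemma radius2_block_graph:
  assumes "d < n" "d \<noteq> v" "c d = 0" "v < n \<Longrightarrow> \<exists>y\<in>N. y < n \<and> y \<noteq> v"
  shows "radius2 n (block_graph n c v N)"
proof -
  have "block_graph n c v N d z \<or> (\<exists>y. block_graph n c v N d y \<and> block_graph n c v N y z)"
    if z: "z < n" "z \<noteq> d" for z
  proof (cases "z = v")
    case True
    then obtain y where "y \<in> N" "y < n" "y \<noteq> v"
      using assms z by auto
    then show ?thesis
      using assms z True by (cases "y = d") (auto simp: block_graph_def)
  next
    case False
    then show ?thesis
      using assms z by (auto simp: block_graph_def)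
  qed
  then show ?thesis
    using assms(1) by (auto simp: radius2_def)
qed

lemma sum_nbrs_block:
  fixes f :: "nat \<Rightarrow> real"
  assumes "a < n" "a \<noteq> v" "c a \<noteq> 0" "a \<in> N \<Longrightarrow> v < n"
  shows "sum f (nbrs n (block_graph n c v N) a) =
    sum f (part n c v 0) + sum f (part n c v (c a)) - f a + (if a \<in> N then f v else 0)"
proof -
  have "nbrs n (block_graph n c v N) a =
      (part n c v 0 \<union> (part n c v (c a) - {a})) \<union> (if a \<in> N then {v} else {})"
    using assms by (auto simp: nbrs_def block_graph_def part_def cls_def)
  also have "sum f \<dots> = sum f (part n c v 0 \<union> (part n c v (c a) - {a})) + sum f (if a \<in> N then {v} else {})"
    by (rule sum.union_disjoint) (auto simp: part_def)
  also have "sum f (part n c v 0 \<union> (part n c v (c a) - {a})) =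
      sum f (part n c v 0) + sum f (part n c v (c a) - {a})"
    using assms by (intro sum.union_disjoint) (auto simp: part_def cls_def)
  also have "sum f (part n c v (c a) - {a}) = sum f (part n c v (c a)) - f a"
    using assms by (simp add: sum_diff1 part_def cls_def)
  finally show ?thesis
    by simp
qed

lemma sum_nbrs_dominating:
  fixes f :: "nat \<Rightarrow> real"
  assumes "a < n" "a \<noteq> v" "c a = 0" "a \<in> N \<Longrightarrow> v < n"
  shows "sum f (nbrs n (block_graph n c v N) a) =
    sum f ({..<n} - {v}) - f a + (if a \<in> N then f v else 0)"
proof -
  have "nbrs n (block_graph n c v N) a = ({..<n} - {v} - {a}) \<union> (if a \<in> N then {v} else {})"
    using assms by (auto simp: nbrs_def block_graph_def)
  also have "sum f \<dots> = sum f ({..<n} - {v} - {a}) + sum f (if a \<in> N then {v} else {})"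
    by (rule sum.union_disjoint) auto
  also have "sum f ({..<n} - {v} - {a}) = sum f ({..<n} - {v}) - f a"
    using assms by (subst sum_diff1) auto
  finally show ?thesis
    by simp
qed

lemma nbrs_special:
  assumes "v < n" "N \<subseteq> {..<n} - {v}"
  shows "nbrs n (block_graph n c v N) v = N"
  using assms by (auto simp: nbrs_def block_graph_def)

section \<open>Moving an ordinary vertex between blocks\<close>

lemma part_upd_other: "j \<noteq> i \<Longrightarrow> c x \<noteq> i \<Longrightarrow> part n (c(x := j)) v i = part n c v i"
  by (auto simp: part_def cls_def)

lemma part_upd_same: "x < n \<Longrightarrow> x \<noteq> v \<Longrightarrow> part n (c(x := j)) v j = insert x (part n c v j)"
  by (auto simp: part_def cls_def)

text \<open>Only row \<open>x\<close> gives the change. It gains the difference of the block weights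
  plus \<open>f x\<close>, since the old block weight counts \<open>x\<close> itself; that summand
  makes the gain strict even for equal weights.\<close>

lemma spec_rad_move_vertex:
  assumes x: "x < n" "x \<noteq> v" "c x \<noteq> 0" "x \<in> N \<Longrightarrow> v < n" and j: "j \<noteq> 0" "j \<noteq> c x"
    and f: "adj_eigvec n (block_graph n c v N) (spec_rad n (block_graph n c v N)) f" "\<forall>i<n. 0 < f i"
    and le: "sum f (part n c v (c x)) \<le> sum f (part n c v j)"
  shows "spec_rad n (block_graph n c v N) < spec_rad n (block_graph n (c(x := j)) v N)"
proof -
  define c' where "c' = c(x := j)"
  let ?H = "block_graph n c v N" and ?T = "block_graph n c' v N"
  have "c' x = j"
    by (simp add: c'_def)
  then have "sum f (nbrs n ?T x) = sum f (part n c' v 0) + sum f (part n c' v j) - f x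
      + (if x \<in> N then f v else 0)"
    using sum_nbrs_block[of x n v c' N f] x j by simp
  also have "part n c' v 0 = part n c v 0"
    using x j by (simp add: c'_def part_upd_other)
  also have "sum f (part n c' v j) = f x + sum f (part n c v j)"
    using x j unfolding c'_def by (subst part_upd_same) (auto simp: part_def cls_def)
  finally have "sum f (nbrs n ?T x) - sum f (nbrs n ?H x)
      = sum f (part n c v j) - sum f (part n c v (c x)) + f x"
    using sum_nbrs_block[of x n v c N f] x by simp
  also have "\<dots> > 0"
    using le f(2) x by (metis add_nonneg_pos diff_ge_0_iff_ge)
  finally have "0 < 2 * f x * (sum f (nbrs n ?T x) - sum f (nbrs n ?H x))"
    using f(2) x by simp
  also have "\<dots> = qform n ?T f - qform n ?H f"
    using x by (intro qform_one_vertex_change[symmetric] simple_graph_block_graph)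
      (auto simp: block_graph_def c'_def)
  finally show ?thesis
    unfolding c'_def[symmetric] using f(1) by (intro spec_rad_less[OF simple_graph_block_graph]) auto
qed

section \<open>Configurations with a special vertex inside a block\<close>

text \<open>The family in which the climb takes place. It fixes \<open>k\<close>,
  \<open>\<delta>\<close> and a lower bound on the block sizes but not the sizes themselves, so the
  moves below stay inside it. The neighbour of \<open>v\<close> in its own block reflects that
  components are connected and have at least two vertices.\<close>

definition config :: "nat \<Rightarrow> nat \<Rightarrow> nat \<Rightarrow> nat \<Rightarrow> nat \<Rightarrow> (nat \<Rightarrow> nat) \<Rightarrow> nat \<Rightarrow> nat set \<Rightarrow> bool" where
  "config n k \<delta> r h c v N \<longleftrightarrow> v < n \<and> (\<forall>z<n. c z \<le> r) \<and> card (cls n c 0) = k \<and>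
     (\<forall>i\<in>{1..r}. h + 1 \<le> card (cls n c i)) \<and> c v \<noteq> 0 \<and>
     N \<subseteq> {z. z < n \<and> z \<noteq> v \<and> (c z = 0 \<or> c z = c v)} \<and> (\<exists>z\<in>N. c z = c v) \<and> card N = \<delta>"

lemma config_finite: "config n k \<delta> r h c v N \<Longrightarrow> finite N"
  by (rule finite_subset[of _ "{..<n}"]) (auto simp: config_def)

lemma config_radius2:
  assumes "config n k \<delta> r h c v N" "k \<ge> 1"
  shows "radius2 n (block_graph n c v N)"
proof -
  have "card (cls n c 0) \<noteq> 0"
    using assms by (simp add: config_def)
  then obtain d where "d \<in> cls n c 0"
    by fastforce
  then show ?thesis
    using assms by (intro radius2_block_graph[of d]) (auto simp: config_def cls_def)
qed

lemma config_other_block: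
  assumes "config n k \<delta> r h c v N" "r \<ge> 2"
  obtains z where "z < n" "c z \<noteq> 0" "c z \<noteq> c v"
proof -
  define j where "j = (if c v = 1 then 2 else 1 :: nat)"
  have j: "j \<in> {1..r}" "j \<noteq> c v" "j \<noteq> 0"
    using assms(2) by (auto simp: j_def)
  then have "h + 1 \<le> card (cls n c j)"
    using assms(1) unfolding config_def by blast
  then have "card (cls n c j) \<noteq> 0"
    by linarith
  then obtain z where "z \<in> cls n c j"
    by fastforce
  then show thesis
    using that j by (auto simp: cls_def)
qed

text \<open>A Kelmans move from \<open>u\<close> to \<open>d\<close>: the edge from \<open>v\<close>
  to \<open>u\<close> is redirected to \<open>d\<close>, and \<open>u'\<close> remains as a
  neighbour inside the block.\<close>

lemma improve_dominating_nbrs: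
  assumes cfg: "config n k \<delta> r h c v N" and "r \<ge> 2"
    and d: "d < n" "c d = 0" "d \<notin> N" and u: "u \<in> N" "c u = c v" and u': "u' \<in> N" "c u' = c v" "u' \<noteq> u"
  shows "\<exists>N'. config n k \<delta> r h c v N' \<and>
    spec_rad n (block_graph n c v N) < spec_rad n (block_graph n c v N')"
proof -
  let ?N = "insert d (N - {u})"
  let ?H = "block_graph n c v N" and ?T = "block_graph n c v ?N"
  have v: "v < n" "c v \<noteq> 0" and N: "N \<subseteq> {z. z < n \<and> z \<noteq> v \<and> (c z = 0 \<or> c z = c v)}"
    using cfg by (auto simp: config_def)
  have "card ?N = card N"
    using config_finite[OF cfg] d u card_Suc_Diff1[of N u] by simp
  then have cfg': "config n k \<delta> r h c v ?N"
    using cfg d u u' by (auto simp: config_def)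
  have k: "k \<ge> 1"
    using cfg d by (auto simp: config_def cls_def card_gt_0_iff Suc_le_eq)
  obtain z where z: "z < n" "c z \<noteq> 0" "c z \<noteq> c v"
    using config_other_block[OF cfg \<open>r \<ge> 2\<close>] .
  have un: "u < n" "u \<noteq> v"
    using N u by auto
  have "kelmans_le ?H u d ?T"
    using d un v u N by (auto simp: kelmans_le_def block_graph_def)
  \<comment> \<open>Witnesses of strictness: \<open>v\<close> is a new neighbour of
    \<open>d\<close>, and the vertex \<open>z\<close> of another block is adjacent to
    \<open>d\<close> but not to \<open>u\<close>.\<close>
  then have "spec_rad n ?H < spec_rad n ?T"
    using d un v u z
    by (intro spec_rad_kelmans[where z = v and z' = z and u = u and w = d] simple_graph_block_graph
        config_radius2[OF cfg' k]) (auto simp: block_graph_def)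
  then show ?thesis
    using cfg' by blast
qed

lemma card_cls_upd_source:
  "x < n \<Longrightarrow> c x = s \<Longrightarrow> t \<noteq> s \<Longrightarrow> card (cls n (c(x := t)) s) = card (cls n c s) - 1"
proof -
  assume "x < n" "c x = s" "t \<noteq> s"
  then have "cls n (c(x := t)) s = cls n c s - {x}" "x \<in> cls n c s"
    by (auto simp: cls_def)
  then show ?thesis
    by simp
qed

lemma card_cls_upd_target:
  "x < n \<Longrightarrow> c x \<noteq> t \<Longrightarrow> card (cls n (c(x := t)) t) = card (cls n c t) + 1"
proof -
  assume "x < n" "c x \<noteq> t"
  then have "cls n (c(x := t)) t = insert x (cls n c t)" "x \<notin> cls n c t"
    by (auto simp: cls_def)
  then show ?thesis
    by simp
qed

lemma cls_upd_other: "c x \<noteq> i \<Longrightarrow> t \<noteq> i \<Longrightarrow> cls n (c(x := t)) i = cls n c i"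
  by (auto simp: cls_def)

lemma blocks_upd:
  assumes "\<forall>i\<in>{1..r}. q \<le> card (cls n c i)" "x < n" "t \<noteq> c x" "q < card (cls n c (c x))"
  shows "\<forall>i\<in>{1..r}. q \<le> card (cls n (c(x := t)) i)"
proof
  fix i assume "i \<in> {1..r}"
  then have "q \<le> card (cls n c i)"
    using assms(1) by blast
  then show "q \<le> card (cls n (c(x := t)) i)"
    using assms(2-) card_cls_upd_source[of x n c "c x" t] card_cls_upd_target[of x n c t] cls_upd_other[of c x i t n]
    by (cases "i = c x"; cases "i = t") auto
qed

lemma config_move:
  assumes cfg: "config n k \<delta> r h c v N" and x: "x < n" "x \<noteq> v" "x \<notin> N" "c x \<noteq> 0"
    and t: "t \<in> {1..r}" "t \<noteq> c x" and big: "h + 1 < card (cls n c (c x))"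
  shows "config n k \<delta> r h (c(x := t)) v N"
proof -
  have "\<forall>i\<in>{1..r}. h + 1 \<le> card (cls n (c(x := t)) i)"
    using cfg x t big by (intro blocks_upd) (auto simp: config_def)
  moreover have "cls n (c(x := t)) 0 = cls n c 0"
    using x t by (intro cls_upd_other) auto
  moreover have "(c(x := t)) z = c z" if "z \<in> insert v N" for z
    using that x by auto
  ultimately show ?thesis
    using cfg t x unfolding config_def by (auto simp: subset_iff)
qed

text \<open>In the block of \<open>v\<close>, the special vertex and its neighbours take up at most
  \<open>h + 1\<close> places; the other blocks contain no member of \<open>N\<close>.\<close>

lemma config_movable:
  assumes cfg: "config n k \<delta> r h c v N" and s: "s \<noteq> 0" and big: "h + 1 < card (cls n c s)"
    and small: "card (N \<inter> cls n c (c v)) \<le> h"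
  obtains x where "x < n" "x \<noteq> v" "x \<notin> N" "c x = s"
proof -
  have "\<not> cls n c s \<subseteq> insert v (N \<inter> cls n c (c v))"
  proof
    assume "cls n c s \<subseteq> insert v (N \<inter> cls n c (c v))"
    then have "card (cls n c s) \<le> card (insert v (N \<inter> cls n c (c v)))"
      by (intro card_mono) auto
    also have "\<dots> \<le> h + 1"
      using small card_insert_le_m1[of "h + 1" "N \<inter> cls n c (c v)" v] by simp
    finally show False
      using big by simp
  qed
  then obtain x where x: "x \<in> cls n c s" "x \<noteq> v" "x \<notin> N \<inter> cls n c (c v)"
    by blast
  moreover have "x \<notin> N"
    using x s cfg by (auto simp: config_def cls_def)
  ultimately show thesis
    using that by (auto simp: cls_def)
qed

text \<open>Both blocks can spare a vertex, so one may be moved towards the block of larger Perron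
  weight, whichever that is.\<close>

lemma improve_balance:
  assumes cfg: "config n k \<delta> r h c v N" and k: "k \<ge> 1"
    and ij: "i \<in> {1..r}" "j \<in> {1..r}" "i \<noteq> j"
    and big: "h + 1 < card (cls n c i)" "h + 1 < card (cls n c j)"
    and small: "card (N \<inter> cls n c (c v)) \<le> h"
  shows "\<exists>c'. config n k \<delta> r h c' v N \<and>
    spec_rad n (block_graph n c v N) < spec_rad n (block_graph n c' v N)"
proof -
  obtain f where f: "adj_eigvec n (block_graph n c v N) (spec_rad n (block_graph n c v N)) f" "\<forall>i<n. 0 < f i"
    using spec_rad_pos_eigvec[OF simple_graph_block_graph config_radius2[OF cfg k]] .
  have move: ?thesis
    if st: "s \<in> {1..r}" "t \<in> {1..r}" "s \<noteq> t" "h + 1 < card (cls n c s)"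
      and le: "sum f (part n c v s) \<le> sum f (part n c v t)" for s t
  proof -
    obtain x where x: "x < n" "x \<noteq> v" "x \<notin> N" "c x = s"
      using config_movable[OF cfg _ _ small, of s] st by auto
    have "config n k \<delta> r h (c(x := t)) v N"
      using x st by (intro config_move[OF cfg]) auto
    moreover have "spec_rad n (block_graph n c v N) < spec_rad n (block_graph n (c(x := t)) v N)"
      using x st le by (intro spec_rad_move_vertex[OF _ _ _ _ _ _ f]) auto
    ultimately show ?thesis
      by blast
  qed
  show ?thesis
    using move[of i j] move[of j i] ij big by fastforce
qed

lemma cls_witness: "card (cls n c i) \<noteq> 0 \<Longrightarrow> \<exists>z<n. c z = i"
  by (metis (mono_tags, lifting) Collect_empty_eq card.empty cls_def)

lemma card_cls_swap_labels:
  assumes "v < n" "x < n" "v \<noteq> x" "c v = s" "c x = t" "s \<noteq> t"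
  shows "card (cls n (c(x := s, v := t)) l) = card (cls n c l)"
proof -
  have 1: "cls n (c(x := s, v := t)) s = insert x (cls n c s - {v})"
      "cls n (c(x := s, v := t)) t = insert v (cls n c t - {x})"
    using assms by (auto simp: cls_def)
  have "v \<in> cls n c s" "x \<notin> cls n c s" "x \<in> cls n c t" "v \<notin> cls n c t"
    using assms by (auto simp: cls_def)
  then have "card (insert x (cls n c s - {v})) = card (cls n c s)"
      "card (insert v (cls n c t - {x})) = card (cls n c t)"
    using card_Suc_Diff1[of "cls n c s" v] card_Suc_Diff1[of "cls n c t" x] by auto
  moreover have "cls n (c(x := s, v := t)) l = cls n c l" if "l \<noteq> s" "l \<noteq> t"
    using that assms by (auto simp: cls_def)
  ultimately show ?thesis
    using 1 by metis
qed

text \<open>If block \<open>j\<close> is at least as heavy as the block of \<open>v\<close>, moving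
  an ordinary vertex into it suffices. Otherwise \<open>v\<close> is compared with a vertex
  \<open>x\<close> of block \<open>j\<close>: they are exchanged if \<open>f v < f x\<close>, and if
  not, \<open>x\<close> becomes the special vertex where it stands. In both cases the
  \<open>a\<close> neighbours of \<open>v\<close> in its block are replaced by \<open>a\<close>
  vertices of block \<open>j\<close>.\<close>

lemma improve_special_block:
  assumes cfg: "config n k \<delta> r h c v N" and k: "k \<ge> 1"
    and big: "h + 1 < card (cls n c (c v))"
    and j: "j \<in> {1..r}" "j \<noteq> c v" "card (cls n c j) = h + 1"
    and small: "card (N \<inter> cls n c (c v)) \<le> h"
  shows "\<exists>c' v' N'. config n k \<delta> r h c' v' N' \<and>
    spec_rad n (block_graph n c v N) < spec_rad n (block_graph n c' v' N')"
proof -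
  let ?H = "block_graph n c v N"
  define i where "i = c v"
  define \<rho> where "\<rho> = spec_rad n ?H"
  obtain f where f: "adj_eigvec n ?H \<rho> f" and pos: "\<forall>i<n. 0 < f i"
    using spec_rad_pos_eigvec[OF simple_graph_block_graph config_radius2[OF cfg k]] unfolding \<rho>_def .
  have v: "v < n" "i \<noteq> 0" "i \<le> r" and N: "N \<subseteq> {z. z < n \<and> z \<noteq> v \<and> (c z = 0 \<or> c z = i)}"
    and cz: "\<forall>z<n. c z \<le> r" and c0: "card (cls n c 0) = k" and N\<delta>: "card N = \<delta>"
    and blocks: "\<forall>i\<in>{1..r}. h + 1 \<le> card (cls n c i)" and meets: "\<exists>z\<in>N. c z = i"
    using cfg by (auto simp: config_def i_def)
  have ji: "j \<noteq> i" "j \<noteq> 0"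
    using j by (auto simp: i_def)
  define S where "S l = sum f (part n c v l)" for l
  \<comment> \<open>Eigenvalue equation with \<open>f z\<close> brought to the left: the right-hand
    side depends only on the label of \<open>z\<close> and on membership in
    \<open>N\<close>.\<close>
  have row: "(\<rho> + 1) * f z = S 0 + S (c z) + (if z \<in> N then f v else 0)" if "z < n" "z \<noteq> v" "c z \<noteq> 0" for z
  proof -
    have "\<rho> * f z = sum f (nbrs n ?H z)"
      using f that by (simp add: adj_eigvec_def)
    also have "\<dots> = S 0 + S (c z) - f z + (if z \<in> N then f v else 0)"
      using sum_nbrs_block[of z n v c N f] that v by (simp add: S_def)
    finally show ?thesis
      by (simp add: algebra_simps)
  qed
  show ?thesis
  proof (cases "S i \<le> S j")
    case True
    obtain x where x: "x < n" "x \<noteq> v" "x \<notin> N" "c x = i"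
      using config_movable[OF cfg _ big small] v unfolding i_def by auto
    have "config n k \<delta> r h (c(x := j)) v N"
      using x j v big by (intro config_move[OF cfg]) (auto simp: i_def)
    moreover have "spec_rad n ?H < spec_rad n (block_graph n (c(x := j)) v N)"
      using x j ji v True f pos by (intro spec_rad_move_vertex[where f = f]) (auto simp: S_def \<rho>_def)
    ultimately show ?thesis
      by blast
  next
    case False
    define e where "e = S i - S j"
    have e: "e > 0"
      using False by (simp add: e_def)
    have partj: "part n c v j = cls n c j"
      using ji by (auto simp: part_def cls_def i_def)
    have "cls n c j \<noteq> {}"
      using j(3) by auto
    then obtain x where "x \<in> cls n c j"
      by blast
    then have x: "x < n" "c x = j" "x \<noteq> v" "x \<notin> N" "x \<in> cls n c j"
      using ji N by (auto simp: cls_def i_def)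
    have S0: "0 \<le> S 0"
      unfolding S_def using pos by (intro sum_nonneg) (auto simp: part_def cls_def less_imp_le)
    have Sj0: "0 < S j"
      unfolding S_def partj using pos x by (intro sum_pos) (auto simp: cls_def)
    define g where "g = f x"
    have g: "g > 0"
      using pos x by (simp add: g_def)
    have rowg: "(\<rho> + 1) * g = S 0 + S j"
      using row[of x] x ji by (simp add: g_def)
    have \<rho>1: "\<rho> + 1 > 0"
      using rowg S0 Sj0 g by (metis add_nonneg_pos zero_less_mult_pos2)
    \<comment> \<open>Block \<open>j\<close> contains neither \<open>v\<close> nor a neighbour of
      \<open>v\<close>, so all its entries agree.\<close>
    have fj: "f z = g" if "z \<in> cls n c j" for z
    proof -
      have "z < n" "c z = j" "z \<noteq> v" "z \<notin> N"
        using that ji N by (auto simp: cls_def i_def)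
      then have "(\<rho> + 1) * f z = (\<rho> + 1) * g"
        using row[of z] ji unfolding rowg by simp
      then show ?thesis
        using \<rho>1 by simp
    qed
    have Sj: "S j = (real h + 1) * g"
      unfolding S_def partj using fj j(3) by simp
    have \<rho>h: "real h \<le> \<rho>"
    proof -
      have "(real h + 1) * g \<le> (\<rho> + 1) * g"
        using rowg S0 Sj by simp
      then show ?thesis
        using g by simp
    qed
    define N1 where "N1 = N \<inter> cls n c i"
    define a where "a = card N1"
    have a: "a \<le> h"
      using small by (simp add: a_def N1_def i_def)
    have finN: "finite N"
      by (rule config_finite[OF cfg])
    have "N1 \<noteq> {}"
      using meets N by (auto simp: N1_def cls_def)
    then have a0: "a \<noteq> 0"
      using finN by (simp add: a_def N1_def)
    \<comment> \<open>The common entry of the neighbours of \<open>v\<close> in block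
      \<open>i\<close>, read off from the row equation.\<close>
    define u where "u = (S 0 + S i + f v) / (\<rho> + 1)"
    have fu: "f z = u" if "z \<in> N1" for z
      using row[of z] that N v \<rho>1 by (auto simp: u_def N1_def cls_def field_simps)
    have sumN1: "sum f N1 = real a * u"
      using fu by (simp add: a_def)
    have "h \<le> card (cls n c j - {x})"
      using j(3) x by simp
    then obtain N2 where N2: "N2 \<subseteq> cls n c j - {x}" "card N2 = a"
      using a by (meson le_trans obtain_subset_with_card_n)
    have finN2: "finite N2"
      using N2 by (meson finite_Diff finite_cls finite_subset)
    have sumN2: "sum f N2 = real a * g"
      using fj N2 by (subst sum.cong[of N2 N2 f "\<lambda>_. g"]) auto
    define N0 where "N0 = N - cls n c i"
    have N0: "N0 \<subseteq> cls n c 0"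
      using N by (auto simp: N0_def cls_def)
    have NN: "N = N0 \<union> N1" "N0 \<inter> N1 = {}"
      by (auto simp: N0_def N1_def)
    have fin0: "finite N0"
      using finN by (simp add: N0_def)
    have sumN: "sum f N = sum f N0 + real a * u"
      using NN finN by (metis sum.union_disjoint finite_Un sumN1)
    have cardN: "\<delta> = card N0 + a"
      using NN finN N\<delta> unfolding a_def by (metis card_Un_disjoint finite_Un)
    define N' where "N' = N0 \<union> N2"
    have disj: "N0 \<inter> N2 = {}"
      using N0 N2(1) ji by (fastforce simp: cls_def)
    have sumN': "sum f N' = sum f N0 + real a * g"
      unfolding N'_def using disj fin0 finN2 sumN2 by (simp add: sum.union_disjoint)
    have cardN': "card N' = \<delta>"
      unfolding N'_def using disj fin0 finN2 N2 cardN by (simp add: card_Un_disjoint)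
    have N'sub: "N' \<subseteq> {z. z < n \<and> z \<noteq> x \<and> z \<noteq> v \<and> (c z = 0 \<or> c z = j)}"
      using N0 N2 ji v x by (auto simp: N'_def cls_def i_def)
    have "N2 \<noteq> {}"
      using N2(2) a0 by auto
    then have N'meets: "\<exists>z\<in>N'. c z = j"
      using N2(1) by (auto simp: N'_def cls_def)
    have Hx: "sum f (nbrs n ?H x) = S 0 + S j - g"
      using sum_nbrs_block[of x n v c N f] x ji by (simp add: S_def g_def)
    have Hv: "sum f (nbrs n ?H v) = sum f N0 + real a * u"
      using sumN N v by (subst nbrs_special) auto
    have nHxv: "\<not> ?H x v" "\<not> ?H v x"
      using x by (auto simp: block_graph_def)
    show ?thesis
    proof (cases "f v < g")
      case True
      define c' where "c' = c(x := i, v := j)"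
      let ?T = "block_graph n c' v N'"
      have c': "c' v = j" "c' x = i" "\<And>z. z \<noteq> v \<Longrightarrow> z \<noteq> x \<Longrightarrow> c' z = c z"
        using x by (auto simp: c'_def)
      have cards: "card (cls n c' l) = card (cls n c l)" for l
        unfolding c'_def using v x ji by (intro card_cls_swap_labels) (auto simp: i_def)
      have "\<forall>z<n. c' z \<le> r"
        using cz j v by (auto simp: c'_def)
      moreover have "N' \<subseteq> {z. z < n \<and> z \<noteq> v \<and> (c' z = 0 \<or> c' z = c' v)}"
        using N'sub c' by auto
      moreover have "\<exists>z\<in>N'. c' z = c' v"
        using N'meets N'sub c' by force
      ultimately have cfg': "config n k \<delta> r h c' v N'"
        using v c0 blocks cardN' ji unfolding config_def cards by (auto simp: c')
      have "part n c' v 0 = part n c v 0" "part n c' v i = insert x (part n c v i)" "x \<notin> part n c v i"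
        using x ji v by (auto simp: part_def cls_def c'_def i_def)
      then have "sum f (nbrs n ?T x) = S 0 + S i"
        using sum_nbrs_block[of x n v c' N' f] x v N'sub by (auto simp: c' S_def g_def)
      moreover have "sum f (nbrs n ?T v) = sum f N0 + real a * g"
        using sumN' N'sub v by (subst nbrs_special) auto
      moreover have "qform n ?T f - qform n ?H f =
          2 * f x * (sum f (nbrs n ?T x) - sum f (nbrs n ?H x)) + 2 * f v * (sum f (nbrs n ?T v) - sum f (nbrs n ?H v))"
        using x v N'sub nHxv by (intro qform_two_vertex_change simple_graph_block_graph)
          (auto simp: block_graph_def c')
      \<comment> \<open>Row \<open>x\<close> gains \<open>e + g\<close> and row \<open>v\<close>
        loses \<open>a * (u - g)\<close>. The loss is at most \<open>e + f v\<close> because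
        \<open>a <= \<rho> + 1\<close>, so \<open>f v < g\<close> decides the comparison.\<close>
      ultimately have gain: "qform n ?T f - qform n ?H f = 2 * (g * (e + g)) - 2 * (f v * (real a * (u - g)))"
        using Hx Hv by (simp add: g_def e_def algebra_simps)
      have "(\<rho> + 1) * (u - g) = e + f v"
        using rowg \<rho>1 by (simp add: u_def e_def right_diff_distrib)
      moreover have "real a \<le> \<rho> + 1"
        using a \<rho>h by simp
      moreover have "0 < f v"
        using pos v by simp
      ultimately have ug: "real a * (u - g) \<le> e + f v"
        using e \<rho>1 by (metis add_pos_pos less_imp_le mult_right_mono zero_less_mult_pos)
      have "f v * (real a * (u - g)) \<le> f v * (e + f v)"
        using ug \<open>0 < f v\<close> by (intro mult_left_mono) auto
      also have "\<dots> < g * (e + g)"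
        using True e \<open>0 < f v\<close> by (intro mult_strict_mono) auto
      finally have "qform n ?H f < qform n ?T f"
        using gain by linarith
      then have "spec_rad n ?H < spec_rad n ?T"
        using f by (intro spec_rad_less[OF simple_graph_block_graph]) (auto simp: \<rho>_def)
      then show ?thesis
        using cfg' by blast
    next
      case False
      let ?T = "block_graph n c x N'"
      have cfg': "config n k \<delta> r h c x N'"
        using x c0 blocks cardN' ji N'sub N'meets cz unfolding config_def by auto
      have "part n c x 0 = part n c v 0" "part n c x i = insert v (part n c v i)" "v \<notin> part n c v i"
        using x ji v by (auto simp: part_def cls_def i_def)
      then have Tv: "sum f (nbrs n ?T v) = S 0 + S i"
        using sum_nbrs_block[of v n x c N' f] x v N'sub by (auto simp: S_def i_def)
      have Tx: "sum f (nbrs n ?T x) = sum f N0 + real a * g"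
        using sumN' N'sub x by (subst nbrs_special) auto
      have "qform n ?T f - qform n ?H f =
          2 * f x * (sum f (nbrs n ?T x) - sum f (nbrs n ?H x)) + 2 * f v * (sum f (nbrs n ?T v) - sum f (nbrs n ?H v))"
        using x v N'sub nHxv by (intro qform_two_vertex_change simple_graph_block_graph)
          (auto simp: block_graph_def)
      \<comment> \<open>The weight \<open>S 0 - sum f N0\<close> of the dominating vertices missed
        by \<open>v\<close> is won at \<open>v\<close> and lost at \<open>x\<close>; since
        \<open>g <= f v\<close>, this part of the balance is nonnegative.\<close>
      then have gain: "qform n ?T f - qform n ?H f =
          2 * (f v * (S 0 - sum f N0 + (S i - real a * u))) - 2 * (g * (S 0 - sum f N0 + (real h - real a) * g))"
        using Hx Hv Tx Tv Sj by (simp add: g_def algebra_simps)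
      have P: "0 \<le> S 0 - sum f N0"
      proof -
        have "N0 \<subseteq> part n c v 0"
          using N0 v by (auto simp: part_def cls_def i_def)
        then have "sum f N0 \<le> S 0"
          unfolding S_def using pos by (intro sum_mono2) (auto simp: part_def cls_def less_imp_le)
        then show ?thesis
          by simp
      qed
      have N1p: "N1 \<subseteq> part n c v i"
        using N by (auto simp: N1_def part_def cls_def)
      have ge: "g \<le> f z" if "z \<in> part n c v i - N1" for z
      proof -
        have "(\<rho> + 1) * g \<le> (\<rho> + 1) * f z"
          using row[of z] that e v pos unfolding rowg e_def by (auto simp: part_def cls_def N1_def)
        then show ?thesis
          using \<rho>1 by simp
      qed
      \<comment> \<open>Block \<open>i\<close> has at least \<open>h + 2\<close> vertices including
        \<open>v\<close>. The vertex beyond \<open>h + 1\<close> provides the surplus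
        \<open>g\<close> that makes the comparison strict.\<close>
      have "card (part n c v i) = card (cls n c i) - 1"
        using v by (simp add: part_def cls_def i_def)
      then have "h + 1 \<le> card (part n c v i)"
        using big by (simp add: i_def)
      then have "h + 1 - a \<le> card (part n c v i - N1)"
        using N1p a finN by (subst card_Diff_subset) (auto simp: N1_def a_def)
      then have "real h + 1 - real a \<le> real (card (part n c v i - N1))"
        using a by linarith
      then have "(real h + 1 - real a) * g \<le> real (card (part n c v i - N1)) * g"
        using g by (intro mult_right_mono) auto
      also have "\<dots> \<le> sum f (part n c v i - N1)"
        using ge by (intro sum_bounded_below) auto
      also have "\<dots> = S i - real a * u"
        unfolding S_def sumN1[symmetric] using N1p by (intro sum_diff) auto
      finally have si: "(real h + 1 - real a) * g \<le> S i - real a * u" .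
      have nn: "0 \<le> (real h + 1 - real a) * g"
        using a g by simp
      have "g * (S 0 - sum f N0 + (real h - real a) * g) < g * (S 0 - sum f N0 + (real h + 1 - real a) * g)"
        using g by (simp add: algebra_simps)
      also have "\<dots> \<le> f v * (S 0 - sum f N0 + (S i - real a * u))"
        using False g P si nn by (intro mult_mono) auto
      finally have "qform n ?H f < qform n ?T f"
        using gain by linarith
      then have "spec_rad n ?H < spec_rad n ?T"
        using f by (intro spec_rad_less[OF simple_graph_block_graph]) (auto simp: \<rho>_def)
      then show ?thesis
        using cfg' by blast
    qed
  qed
qed

section \<open>Special vertex in the dominating clique\<close>

text \<open>A Kelmans move from \<open>v\<close> to a vertex \<open>x\<close> of the block of
  \<open>z\<close>: \<open>x\<close> is promoted to the dominating clique and \<open>v\<close> takes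
  its place. The vertex \<open>z\<close> stays adjacent to \<open>v\<close>, as
  \<open>config\<close> demands.\<close>

lemma promote_with_block_nbr:
  assumes v: "v < n" "c v = 0" and cz: "\<forall>z<n. c z \<le> r" and c0: "card (cls n c 0) = k"
    and blocks: "\<forall>i\<in>{1..r}. h + 1 \<le> card (cls n c i)"
    and N: "N \<subseteq> {..<n} - {v}" "card N = \<delta>" and z: "z \<in> N" "c z \<noteq> 0"
    and r: "r \<ge> 2" and h: "h \<ge> 1" and \<delta>: "\<delta> < k + h"
  shows "\<exists>c' N'. config n k \<delta> r h c' v N' \<and>
    spec_rad n (block_graph n c v N) < spec_rad n (block_graph n c' v N')"
proof -
  define i where "i = c z"
  have zn: "z < n" "z \<noteq> v"
    using z N by auto
  have i: "i \<in> {1..r}"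
    using z cz zn by (auto simp: i_def)
  then have ci: "h + 1 \<le> card (cls n c i)"
    using blocks by blast
  have "\<not> cls n c i \<subseteq> {z}"
  proof
    assume "cls n c i \<subseteq> {z}"
    then have "card (cls n c i) \<le> card {z}"
      by (intro card_mono) auto
    then show False
      using ci h by simp
  qed
  then obtain x where x: "x < n" "c x = i" "x \<noteq> z"
    by (auto simp: cls_def)
  have xv: "x \<noteq> v"
    using x i v by auto
  define j where "j = (if i = 1 then 2 else 1 :: nat)"
  have j: "j \<in> {1..r}" "j \<noteq> i" "j \<noteq> 0"
    using r by (auto simp: j_def)
  then have "h + 1 \<le> card (cls n c j)"
    using blocks by blast
  then have "card (cls n c j) \<noteq> 0"
    by linarith
  then obtain w where w: "w < n" "c w = j"
    using cls_witness by blast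
  \<comment> \<open>The vertices that may be adjacent to \<open>v\<close> after the exchange. There
    are at least \<open>k + h > \<delta>\<close> of them, so the common neighbours can be filled up
    to exactly \<open>\<delta>\<close>.\<close>
  define A where "A = (cls n c 0 - {v}) \<union> cls n c i"
  have finA: "finite A"
    by (simp add: A_def)
  have "card A = card (cls n c 0 - {v}) + card (cls n c i)"
    unfolding A_def using i by (intro card_Un_disjoint) (auto simp: cls_def)
  moreover have "card (cls n c 0 - {v}) = k - 1"
    using v c0 by (simp add: cls_def)
  moreover have "k \<ge> 1"
    using v c0 by (auto simp: cls_def card_gt_0_iff Suc_le_eq)
  ultimately have cardA: "k + h \<le> card A"
    using ci by linarith
  have finN: "finite N"
    using N by (meson finite_Diff finite_lessThan finite_subset)
  have "card (N \<inter> A) \<le> \<delta>"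
    using finN N(2) by (metis card_mono inf_le1)
  then obtain N' where N': "N \<inter> A \<subseteq> N'" "N' \<subseteq> A" "card N' = \<delta>"
    using exists_subset_between[of "N \<inter> A" \<delta> A] cardA \<delta> finA by auto
  define c' where "c' = c(x := 0, v := i)"
  have c': "c' v = i" "c' x = 0" "\<And>y. y \<noteq> v \<Longrightarrow> y \<noteq> x \<Longrightarrow> c' y = c y"
    using xv by (auto simp: c'_def)
  have cards: "card (cls n c' l) = card (cls n c l)" for l
    unfolding c'_def using v x xv i by (intro card_cls_swap_labels) auto
  have zA: "z \<in> N'"
    using N'(1) z zn by (auto simp: A_def cls_def i_def)
  have "\<forall>y<n. c' y \<le> r"
    using cz i by (auto simp: c'_def)
  moreover have "N' \<subseteq> {y. y < n \<and> y \<noteq> v \<and> (c' y = 0 \<or> c' y = c' v)}"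
    using N'(2) c' v i by (auto simp: A_def cls_def c'_def)
  moreover have "c' z = c' v"
    using c' zn x by (simp add: i_def)
  ultimately have cfg: "config n k \<delta> r h c' v N'"
    using v c0 blocks N'(3) i zA unfolding config_def cards by (auto simp: c')
  let ?H = "block_graph n c v N" and ?T = "block_graph n c' v N'"
  have K: "kelmans_le ?H v x ?T"
    unfolding kelmans_le_def
  proof (intro conjI allI impI)
    fix y assume "y \<notin> {v, x} \<and> ?H x y \<and> ?H v y"
    then have "y \<in> N \<inter> A" "y < n" "y \<noteq> v"
      using x xv i v by (auto simp: block_graph_def A_def cls_def)
    then show "?T v y"
      using N' v by (auto simp: block_graph_def)
  next
    assume "?H v x"
    then have "x \<in> N \<inter> A"
      using x by (auto simp: block_graph_def A_def cls_def)
    then show "?T v x"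
      using N' v x xv by (auto simp: block_graph_def)
  qed (use x xv c' in \<open>auto simp: block_graph_def\<close>)
  \<comment> \<open>This set has at least \<open>k + h\<close> elements, more than \<open>N\<close>.
    So some \<open>y\<close> in it is adjacent to \<open>x\<close> afterwards but was not adjacent
    to \<open>v\<close>, which is the second witness of strictness.\<close>
  have "\<not> insert w (A - {x}) \<subseteq> N"
  proof
    assume "insert w (A - {x}) \<subseteq> N"
    then have "card (insert w (A - {x})) \<le> \<delta>"
      using N finN card_mono by blast
    moreover have "w \<notin> A" "x \<in> A"
      using w j x by (auto simp: A_def cls_def)
    ultimately show False
      using finA cardA \<delta> card_Suc_Diff1[of A x] by simp
  qed
  then obtain y where y: "y \<in> insert w (A - {x})" "y \<notin> N"
    by blast
  have "y < n" "y \<noteq> v" "y \<noteq> x"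
    using y w x j i v by (auto simp: A_def cls_def)
  moreover have "w \<noteq> v" "w \<noteq> x"
    using w j v x by auto
  ultimately have "spec_rad n ?H < spec_rad n ?T"
    using v x xv w j i y c' K
    by (intro spec_rad_kelmans[where z = w and z' = y and u = v and w = x] simple_graph_block_graph
        config_radius2[OF cfg \<open>k \<ge> 1\<close>]) (auto simp: block_graph_def)
  then show ?thesis
    using cfg by blast
qed

text \<open>A Kelmans move alone would leave \<open>v\<close> without a neighbour in its new block.
  Therefore \<open>v\<close> also trades a dominating neighbour \<open>y\<close> for a vertex
  \<open>x'\<close> of that block, and the loss \<open>f y - f x'\<close> is estimated through the
  eigenvalue equations.\<close>

lemma promote_without_block_nbr:
  assumes v: "v < n" "c v = 0" and cz: "\<forall>z<n. c z \<le> r" and c0: "card (cls n c 0) = k"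
    and blocks: "\<forall>i\<in>{1..r}. h + 1 \<le> card (cls n c i)"
    and N: "N \<subseteq> {..<n} - {v}" "card N = \<delta>" "\<forall>z\<in>N. c z = 0" and "\<delta> \<ge> 1"
    and r: "r \<ge> 2" and h: "h \<ge> 1"
  shows "\<exists>c' N'. config n k \<delta> r h c' v N' \<and>
    spec_rad n (block_graph n c v N) < spec_rad n (block_graph n c' v N')"
proof -
  have "N \<noteq> {}"
    using N(2) \<open>\<delta> \<ge> 1\<close> by auto
  then obtain y where y: "y \<in> N"
    by blast
  then have yn: "y < n" "y \<noteq> v" "c y = 0"
    using N by auto
  have finN: "finite N"
    using N(1) by (meson finite_Diff finite_lessThan finite_subset)
  have "(1::nat) \<in> {1..r}" "(2::nat) \<in> {1..r}"
    using r by auto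
  then have "h + 1 \<le> card (cls n c 1)" "h + 1 \<le> card (cls n c 2)"
    using blocks by blast+
  then have c12: "2 \<le> card (cls n c 1)" "card (cls n c 2) \<noteq> 0"
    using h by linarith+
  obtain w where w: "w < n" "c w = 2"
    using c12(2) cls_witness by blast
  obtain X where "X \<subseteq> cls n c 1" "card X = 2"
    using c12(1) by (meson obtain_subset_with_card_n)
  then obtain x x' where x: "x < n" "c x = 1" and x': "x' < n" "c x' = 1" and "x \<noteq> x'"
    by (auto simp: card_2_iff cls_def)
  have xN: "x \<notin> N" "x' \<notin> N" "w \<notin> N" and xv: "x \<noteq> v" "x' \<noteq> v" "w \<noteq> v"
    using N x x' w v by auto
  define c' where "c' = c(x := 0, v := 1)"
  define N' where "N' = insert x' (N - {y})"
  have c': "c' v = 1" "c' x = 0" "\<And>z. z \<noteq> v \<Longrightarrow> z \<noteq> x \<Longrightarrow> c' z = c z"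
    using xv by (auto simp: c'_def)
  have cards: "card (cls n c' l) = card (cls n c l)" for l
    unfolding c'_def using v x xv by (intro card_cls_swap_labels) auto
  have "\<forall>z<n. c' z \<le> r"
    using cz r by (auto simp: c'_def)
  moreover have "N' \<subseteq> {z. z < n \<and> z \<noteq> v \<and> (c' z = 0 \<or> c' z = c' v)}"
    using N x' xv \<open>x \<noteq> x'\<close> by (auto simp: N'_def c'_def)
  moreover have "\<exists>z\<in>N'. c' z = c' v"
    using x' xv \<open>x \<noteq> x'\<close> by (auto simp: N'_def c'_def)
  moreover have "card N' = \<delta>"
    unfolding N'_def using N(2) y xN finN card_Suc_Diff1[of N y] by simp
  ultimately have cfg: "config n k \<delta> r h c' v N'"
    using v c0 blocks unfolding config_def cards by (auto simp: c')
  let ?H = "block_graph n c v N" and ?T = "block_graph n c' v N'"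
  have "radius2 n ?H"
    using y yn by (intro radius2_block_graph[of y]) auto
  then obtain f where f: "adj_eigvec n ?H (spec_rad n ?H) f" and pos: "\<forall>i<n. 0 < f i"
    using spec_rad_pos_eigvec[OF simple_graph_block_graph] by blast
  define \<rho> where "\<rho> = spec_rad n ?H"
  define U where "U = sum f ({..<n} - {v})"
  define S where "S l = sum f (part n c v l)" for l
  \<comment> \<open>The weight of the blocks other than block 1, which is exactly what row
    \<open>x\<close> gains by the promotion.\<close>
  define R where "R = U - S 0 - S 1"
  have eig: "\<rho> * f z = sum f (nbrs n ?H z)" if "z < n" for z
    using f that by (simp add: adj_eigvec_def \<rho>_def)
  have rowx: "\<rho> * f x = S 0 + S 1 - f x"
    using eig[of x] sum_nbrs_block[of x n v c N f] x xN xv by (simp add: S_def)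
  have rowx': "\<rho> * f x' = S 0 + S 1 - f x'"
    using eig[of x'] sum_nbrs_block[of x' n v c N f] x' xN xv by (simp add: S_def)
  have roww: "\<rho> * f w = S 0 + S 2 - f w"
    using eig[of w] sum_nbrs_block[of w n v c N f] w xN xv by (simp add: S_def)
  have rowy: "\<rho> * f y = U - f y + f v"
    using eig[of y] sum_nbrs_dominating[of y n v c N f] y yn v by (simp add: U_def)
  have rowv: "\<rho> * f v = sum f N"
    using eig[of v] v N by (simp add: nbrs_special)
  have nonneg: "z < n \<Longrightarrow> 0 \<le> f z" for z
    using pos by (simp add: less_imp_le)
  have S1: "f x + f x' \<le> S 1"
  proof -
    have "sum f {x, x'} \<le> S 1"
      unfolding S_def using x x' xv nonneg by (intro sum_mono2) (auto simp: part_def cls_def)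
    then show ?thesis
      using \<open>x \<noteq> x'\<close> by simp
  qed
  have S2: "f w \<le> S 2"
    unfolding S_def using w xv nonneg by (intro member_le_sum) (auto simp: part_def cls_def)
  have SN: "sum f N \<le> S 0"
    unfolding S_def using N nonneg by (intro sum_mono2) (auto simp: part_def cls_def)
  have Rw: "f w \<le> R"
  proof -
    have "sum f (insert w (part n c v 0 \<union> part n c v 1)) \<le> U"
      unfolding U_def using w xv nonneg by (intro sum_mono2) (auto simp: part_def cls_def)
    moreover have "sum f (part n c v 0 \<union> part n c v 1) = S 0 + S 1"
      unfolding S_def by (intro sum.union_disjoint) (auto simp: part_def cls_def)
    moreover have "w \<notin> part n c v 0 \<union> part n c v 1"
      using w by (auto simp: part_def cls_def)
    ultimately show ?thesis
      by (simp add: R_def)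
  qed
  have fpos: "0 < f v" "0 < f x" "0 < f x'" "0 < f w"
    using pos v x x' w by auto
  have "0 \<le> S 0"
    unfolding S_def using nonneg by (intro sum_nonneg) (auto simp: part_def cls_def)
  then have "0 < \<rho> * f x"
    using rowx S1 fpos by linarith
  then have \<rho>0: "0 < \<rho>"
    using fpos by (simp add: zero_less_mult_iff)
  have "(\<rho> + 1) * f x = (\<rho> + 1) * f x'"
    using rowx rowx' by (simp add: algebra_simps)
  then have xx': "f x' = f x"
    using \<rho>0 by simp
  have "1 * f x \<le> \<rho> * f x"
    using rowx S1 xx' \<open>0 \<le> S 0\<close> by simp
  then have \<rho>1: "1 \<le> \<rho>"
    using fpos by (simp only: mult_le_cancel_right_pos)
  have "\<rho> * f v < \<rho> * f x"
    using rowv SN rowx S1 fpos by linarith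
  then have vx: "f v < f x"
    using \<rho>0 by simp
  have "\<rho> * f v \<le> \<rho> * f w"
    using rowv SN roww S2 by linarith
  then have vR: "f v \<le> R"
    using \<rho>0 Rw by simp
  have "sum f (nbrs n ?T x) = U - f x"
    using sum_nbrs_dominating[of x n v c' N' f] x xv xN \<open>x \<noteq> x'\<close> by (simp add: c' U_def N'_def)
  then have gx: "sum f (nbrs n ?T x) - sum f (nbrs n ?H x) = R"
    using eig[of x] rowx x by (simp add: R_def)
  have "sum f (nbrs n ?T v) = sum f N - f y + f x'"
    using N v x' xv y finN xN
    by (subst nbrs_special) (auto simp: N'_def sum_diff1)
  then have gv: "sum f (nbrs n ?T v) - sum f (nbrs n ?H v) = f x - f y"
    using eig[of v] rowv v xx' by simp
  have gain: "qform n ?T f - qform n ?H f = 2 * f x * R + 2 * f v * (f x - f y)"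
    unfolding gx[symmetric] gv[symmetric] using x v xv xN \<open>x \<noteq> x'\<close>
    by (intro qform_two_vertex_change simple_graph_block_graph) (auto simp: block_graph_def c' N'_def)
  \<comment> \<open>The loss factor is thus \<open>f y - f x = (R + f v) / (\<rho> + 1)\<close>.
    With \<open>f v <= R\<close>, \<open>\<rho> >= 1\<close> and \<open>f v < f x\<close> the gain
    \<open>f x * R\<close> outweighs it.\<close>
  have "(\<rho> + 1) * (f x - f y) = - (R + f v)"
    using rowx rowy by (simp add: R_def algebra_simps)
  then have g2: "(\<rho> + 1) * (f x * R + f v * (f x - f y)) = (\<rho> + 1) * (f x * R) - f v * (R + f v)"
    by (metis (no_types, opaque_lifting) distrib_left mult.left_commute mult_minus_right uminus_add_conv_diff add.commute)
  have "f v * (R + f v) \<le> f v * (2 * R)"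
    using vR fpos by (intro mult_left_mono) auto
  also have "\<dots> = 2 * (f v * R)"
    by simp
  also have "\<dots> \<le> (\<rho> + 1) * (f v * R)"
    using \<rho>1 vR fpos by (intro mult_right_mono) auto
  also have "\<dots> < (\<rho> + 1) * (f x * R)"
    using \<rho>0 vx vR fpos by simp
  finally have "0 < (\<rho> + 1) * (f x * R + f v * (f x - f y))"
    using g2 by linarith
  then have "0 < f x * R + f v * (f x - f y)"
    using \<rho>0 by (simp add: zero_less_mult_iff)
  then have "qform n ?H f < qform n ?T f"
    using gain by linarith
  then have "spec_rad n ?H < spec_rad n ?T"
    using f by (intro spec_rad_less[OF simple_graph_block_graph]) auto
  then show ?thesis
    using cfg by blast
qed

text \<open>Neighbours of \<open>v\<close> are first pushed into the dominating clique as far as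
  possible. After that at most one block can be large, and it cannot be that of
  \<open>v\<close>.\<close>

lemma improve_or_terminal:
  assumes cfg: "config n k \<delta> r h c v N" and k: "k \<ge> 1" and r: "r \<ge> 2" and h: "h \<ge> 1" and \<delta>: "\<delta> < k + h"
  shows "(card (N \<inter> cls n c 0) = min (\<delta> - 1) k \<and>
      (\<exists>j\<in>{1..r}. j \<noteq> c v \<and> (\<forall>i\<in>{1..r}. i \<noteq> j \<longrightarrow> card (cls n c i) = h + 1))) \<or>
    (\<exists>c' v' N'. config n k \<delta> r h c' v' N' \<and>
      spec_rad n (block_graph n c v N) < spec_rad n (block_graph n c' v' N'))"
    (is "?terminal \<or> ?improvable")
proof -
  let ?N0 = "N \<inter> cls n c 0" and ?N1 = "N \<inter> cls n c (c v)"
  have finN: "finite N"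
    by (rule config_finite[OF cfg])
  have N: "N \<subseteq> {z. z < n \<and> z \<noteq> v \<and> (c z = 0 \<or> c z = c v)}" "card N = \<delta>" "\<exists>z\<in>N. c z = c v"
    and c0: "card (cls n c 0) = k" and cv: "c v \<in> {1..r}"
    and blocks: "\<forall>i\<in>{1..r}. h + 1 \<le> card (cls n c i)"
    using cfg by (auto simp: config_def)
  have "card N = card (?N0 \<union> ?N1)"
    using N by (intro arg_cong[of _ _ card]) (auto simp: cls_def)
  also have "\<dots> = card ?N0 + card ?N1"
    using finN cv by (intro card_Un_disjoint) (auto simp: cls_def)
  finally have split: "\<delta> = card ?N0 + card ?N1"
    using N by simp
  have "?N1 \<noteq> {}"
    using N by (auto simp: cls_def)
  then have a: "1 \<le> card ?N1"
    using finN by (simp add: Suc_le_eq card_gt_0_iff)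
  have b: "card ?N0 \<le> k"
    unfolding c0[symmetric] by (intro card_mono) auto
  show ?thesis
  proof (cases "card ?N0 = min (\<delta> - 1) k")
    case False
    then have "2 \<le> card ?N1" "card ?N0 < k"
      using split a b by auto
    obtain X where "X \<subseteq> ?N1" "card X = 2"
      using \<open>2 \<le> card ?N1\<close> by (meson obtain_subset_with_card_n)
    then obtain u u' where u: "u \<in> N" "c u = c v" and u': "u' \<in> N" "c u' = c v" "u' \<noteq> u"
      by (auto simp: card_2_iff cls_def)
    have "\<not> cls n c 0 \<subseteq> N"
      using \<open>card ?N0 < k\<close> c0 by (metis inf.absorb_iff2 less_irrefl)
    then obtain d where "d < n" "c d = 0" "d \<notin> N"
      by (auto simp: cls_def)
    then show ?thesis
      using improve_dominating_nbrs[OF cfg r _ _ _ u u'] by blast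
  next
    case True
    \<comment> \<open>Now \<open>v\<close> has either one neighbour or \<open>\<delta> - k\<close>
      neighbours in its block, and both numbers are at most \<open>h\<close>.\<close>
    then have small: "card ?N1 \<le> h"
      using split \<delta> h a by (auto simp: min_def split: if_splits)
    define j0 where "j0 = (if c v = 1 then 2 else 1 :: nat)"
    have j0: "j0 \<in> {1..r}" "j0 \<noteq> c v"
      using r by (auto simp: j0_def)
    show ?thesis
    proof (rule disjCI)
      assume no: "\<not> ?improvable"
      have eq: "card (cls n c i) = h + 1" if "i \<in> {1..r}" "\<not> h + 1 < card (cls n c i)" for i
        using that blocks by (meson le_antisym not_le)
      have two: "i = j" if "i \<in> {1..r}" "j \<in> {1..r}" "h + 1 < card (cls n c i)" "h + 1 < card (cls n c j)" for i j
        using improve_balance[OF cfg k that(1,2) _ that(3,4) small] no by blast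
      have "\<not> h + 1 < card (cls n c (c v))"
      proof
        assume big: "h + 1 < card (cls n c (c v))"
        have "card (cls n c j0) = h + 1"
          using eq two big cv j0 by blast
        then show False
          using improve_special_block[OF cfg k big j0 _ small] no by blast
      qed
      then have "\<exists>j\<in>{1..r}. j \<noteq> c v \<and> (\<forall>i\<in>{1..r}. i \<noteq> j \<longrightarrow> card (cls n c i) = h + 1)"
        using eq two j0 by metis
      then show ?terminal
        using True by blast
    qed
  qed
qed

section \<open>Isomorphism of terminal configurations\<close>

lemma bij_betw_of_card_fibres:
  assumes "finite A" "finite B" and card: "\<And>l. card {a \<in> A. s a = l} = card {b \<in> B. t b = l}"
  shows "\<exists>f. bij_betw f A B \<and> (\<forall>a\<in>A. t (f a) = s a)"
proof -
  have "\<exists>g. bij_betw g {a \<in> A. s a = l} {b \<in> B. t b = l}" for l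
    using assms by (intro finite_same_card_bij) auto
  then obtain g where g: "\<And>l. bij_betw (g l) {a \<in> A. s a = l} {b \<in> B. t b = l}"
    by metis
  define f where "f a = g (s a) a" for a
  have f: "f a \<in> B" "t (f a) = s a" if "a \<in> A" for a
    using bij_betwE[OF g[of "s a"]] that by (auto simp: f_def)
  have "inj_on f A"
  proof (rule inj_onI)
    fix a b assume ab: "a \<in> A" "b \<in> A" "f a = f b"
    then have "s a = s b"
      using f by metis
    then show "a = b"
      using ab g[of "s a"] by (auto simp: f_def bij_betw_def inj_on_def)
  qed
  moreover have "f ` A = B"
  proof
    show "f ` A \<subseteq> B"
      using f by auto
    show "B \<subseteq> f ` A"
    proof
      fix b assume "b \<in> B"
      then have "b \<in> g (t b) ` {a \<in> A. s a = t b}"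
        using g[of "t b"] by (auto simp: bij_betw_def)
      then obtain a where "a \<in> A" "s a = t b" "b = g (t b) a"
        by blast
      then have "b = f a"
        by (simp add: f_def)
      then show "b \<in> f ` A"
        using \<open>a \<in> A\<close> by blast
    qed
  qed
  ultimately show ?thesis
    using f by (auto simp: bij_betw_def)
qed

text \<open>Adjacency depends only on the label, on membership in \<open>N\<close> and on being
  special. A bijection preserving these data is an isomorphism, and matching fibre sizes provide
  one.\<close>

lemma block_graph_iso:
  assumes v: "v < n \<longleftrightarrow> v' < n"
    and card: "\<And>i. card (part n c v i) = card (part n c' v' i)"
    and cardN: "\<And>i. card (part n c v i \<inter> N) = card (part n c' v' i \<inter> N')"
  shows "graph_iso n (block_graph n c v N) (block_graph n c' v' N')"
proof -
  define s where "s u = (if u = v then None else Some (c u, u \<in> N))" for u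
  define t where "t u = (if u = v' then None else Some (c' u, u \<in> N'))" for u
  have "card {a \<in> {0..<n}. s a = l} = card {b \<in> {0..<n}. t b = l}" for l
  proof (cases l)
    case None
    then have "{a \<in> {0..<n}. s a = l} = (if v < n then {v} else {})"
        "{b \<in> {0..<n}. t b = l} = (if v' < n then {v'} else {})"
      by (auto simp: s_def t_def)
    then show ?thesis
      using v by simp
  next
    case (Some p)
    obtain i b where p: "p = (i, b)"
      by fastforce
    have *: "{a \<in> {0..<n}. s a = l} = (if b then part n c v i \<inter> N else part n c v i - (part n c v i \<inter> N))"
        "{a \<in> {0..<n}. t a = l} = (if b then part n c' v' i \<inter> N' else part n c' v' i - (part n c' v' i \<inter> N'))"
      using Some p by (auto simp: s_def t_def part_def cls_def)
    show ?thesis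
      unfolding * using card cardN by (simp add: card_Diff_subset)
  qed
  then obtain f where f: "bij_betw f {0..<n} {0..<n}" "\<And>a. a \<in> {0..<n} \<Longrightarrow> t (f a) = s a"
    using bij_betw_of_card_fibres[of "{0..<n}" "{0..<n}" s t] by auto
  have st: "f a = v' \<longleftrightarrow> a = v" "a \<noteq> v \<Longrightarrow> c' (f a) = c a \<and> (f a \<in> N' \<longleftrightarrow> a \<in> N)" if "a < n" for a
    using f(2)[of a] that by (auto simp: s_def t_def split: if_splits)
  have inj: "f a = f b \<longleftrightarrow> a = b" if "a < n" "b < n" for a b
    using f(1) that by (auto simp: bij_betw_def inj_on_def)
  have lt: "f a < n" if "a < n" for a
    using f(1) that by (auto simp: bij_betw_def)
  have "block_graph n c v N a b \<longleftrightarrow> block_graph n c' v' N' (f a) (f b)" if "a < n" "b < n" for a b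
    unfolding block_graph_def using that st inj lt by (cases "a = v"; cases "b = v") simp_all
  then show ?thesis
    unfolding graph_iso_def using f(1) by (intro exI[of _ f]) auto
qed

lemma sum_card_cls:
  assumes "\<forall>z<n. c z \<le> r"
  shows "(\<Sum>i\<le>r. card (cls n c i)) = n"
proof -
  have "(\<Sum>i\<le>r. card (cls n c i)) = card (\<Union>i\<le>r. cls n c i)"
    by (rule card_UN_disjoint[symmetric]) (auto simp: cls_def)
  also have "(\<Union>i\<le>r. cls n c i) = {..<n}"
    using assms by (auto simp: cls_def)
  finally show ?thesis
    by simp
qed

text \<open>The sizes add up to \<open>n\<close>, so class 1 is determined by the others.\<close>

lemma card_cls_eqI:
  assumes c: "\<forall>z<n. c z \<le> r" "\<forall>z<n. c' z \<le> r" and "r \<ge> 1"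
    and eq: "\<And>i. i \<le> r \<Longrightarrow> i \<noteq> 1 \<Longrightarrow> card (cls n c i) = card (cls n c' i)"
  shows "card (cls n c i) = card (cls n c' i)"
proof -
  have split: "(\<Sum>i\<le>r. g i) = g 1 + (\<Sum>i\<in>{..r} - {1}. g i)" for g :: "nat \<Rightarrow> nat"
    using \<open>r \<ge> 1\<close> by (intro sum.remove) auto
  have "card (cls n c 1) + (\<Sum>i\<in>{..r} - {1}. card (cls n c i)) =
      card (cls n c' 1) + (\<Sum>i\<in>{..r} - {1}. card (cls n c' i))"
    using sum_card_cls[OF c(1)] sum_card_cls[OF c(2)] split by metis
  moreover have "(\<Sum>i\<in>{..r} - {1}. card (cls n c i)) = (\<Sum>i\<in>{..r} - {1}. card (cls n c' i))"
    using eq by (intro sum.cong) auto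
  ultimately have "card (cls n c 1) = card (cls n c' 1)"
    by simp
  moreover have "cls n c i = {}" "cls n c' i = {}" if "\<not> i \<le> r"
    using that c by (auto simp: cls_def)
  ultimately show ?thesis
    using eq by (cases "i \<le> r"; cases "i = 1") auto
qed

text \<open>With the large block numbered 1 and the block of \<open>v\<close> numbered
  \<open>r\<close>, all class sizes and the split of \<open>N\<close> between clique and block are
  forced.\<close>

lemma terminal_config_iso:
  assumes cfg: "config n k \<delta> r h c v N" "config n k \<delta> r h c' v' N'" and r: "r \<ge> 2"
    and cv: "c v = r" "c' v' = r"
    and cards: "\<forall>i\<in>{2..r}. card (cls n c i) = h + 1" "\<forall>i\<in>{2..r}. card (cls n c' i) = h + 1"
    and N0: "card (N \<inter> cls n c 0) = card (N' \<inter> cls n c' 0)"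
  shows "graph_iso n (block_graph n c v N) (block_graph n c' v' N')"
proof -
  have lab: "\<forall>z<n. c z \<le> r" "\<forall>z<n. c' z \<le> r"
    using cfg unfolding config_def by blast+
  have eq0: "card (cls n c i) = card (cls n c' i)" if "i \<le> r" "i \<noteq> 1" for i
    using cfg cards that by (cases "i = 0") (auto simp: config_def)
  have eq: "card (cls n c i) = card (cls n c' i)" for i
    using r by (intro card_cls_eqI[OF lab _ eq0]) simp_all
  have v: "v < n" "v' < n"
    using cfg by (auto simp: config_def)
  have part: "part n c v i = (if i = r then cls n c r - {v} else cls n c i)"
      "part n c' v' i = (if i = r then cls n c' r - {v'} else cls n c' i)" for i
    using cv by (auto simp: part_def cls_def)
  have card_part: "card (part n c v i) = card (part n c' v' i)" for i
    unfolding part using v cv eq by (auto simp: cls_def)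
  have split: "card N = card (N \<inter> cls n c 0) + card (N \<inter> cls n c r)"
      "\<And>i. i \<noteq> 0 \<Longrightarrow> i \<noteq> r \<Longrightarrow> cls n c i \<inter> N = {}" "v \<notin> N"
    if cfg: "config n k \<delta> r h c v N" and "c v = r" for c v N
  proof -
    have N: "N \<subseteq> {z. z < n \<and> z \<noteq> v \<and> (c z = 0 \<or> c z = r)}"
      using that by (auto simp: config_def)
    then have "card N = card ((N \<inter> cls n c 0) \<union> (N \<inter> cls n c r))"
      by (intro arg_cong[of _ _ card]) (auto simp: cls_def)
    also have "\<dots> = card (N \<inter> cls n c 0) + card (N \<inter> cls n c r)"
      using r config_finite[OF cfg] by (intro card_Un_disjoint) (auto simp: cls_def)
    finally show "card N = card (N \<inter> cls n c 0) + card (N \<inter> cls n c r)" .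
    show "cls n c i \<inter> N = {}" if "i \<noteq> 0" "i \<noteq> r" for i
      using N that by (auto simp: cls_def)
    show "v \<notin> N"
      using N by auto
  qed
  have "card (N \<inter> cls n c r) = card (N' \<inter> cls n c' r)"
    using split(1)[OF cfg(1) cv(1)] split(1)[OF cfg(2) cv(2)] N0 cfg by (simp add: config_def)
  moreover have "part n c v i \<inter> N = N \<inter> cls n c i" "part n c' v' i \<inter> N' = N' \<inter> cls n c' i" for i
    using split(3)[OF cfg(1) cv(1)] split(3)[OF cfg(2) cv(2)] by (auto simp: part_def)
  moreover have "N \<inter> cls n c i = {}" "N' \<inter> cls n c' i = {}" if "i \<noteq> 0" "i \<noteq> r" for i
    using split(2)[OF cfg(1) cv(1) that] split(2)[OF cfg(2) cv(2) that] by (simp_all add: Int_commute)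
  ultimately have "card (part n c v i \<inter> N) = card (part n c' v' i \<inter> N')" for i
    using N0 by (metis card.empty)
  then show ?thesis
    using v card_part by (intro block_graph_iso) auto
qed

section \<open>Renumbering the blocks\<close>

lemma relabel_permutation:
  fixes j l r :: nat
  assumes "j \<in> {1..r}" "l \<in> {1..r}" "j \<noteq> l"
  obtains p where "bij p" "p 0 = 0" "p ` {1..r} = {1..r}" "p j = 1" "p l = r"
proof -
  \<comment> \<open>The place to which \<open>l\<close> is carried when \<open>j\<close> goes to 1.
    As \<open>y\<close> and \<open>r\<close> differ from 1, the second transposition does not
    disturb \<open>p j = 1\<close>.\<close>
  define y where "y = Transposition.transpose j 1 l"
  define p where "p = Transposition.transpose y r \<circ> Transposition.transpose j 1"
  have y: "y \<in> {1..r}" "y \<noteq> 1"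
    using assms by (auto simp: y_def Transposition.transpose_def)
  have "bij p"
    by (simp add: p_def bij_comp)
  moreover have "p 0 = 0"
    using assms y by (auto simp: p_def Transposition.transpose_def)
  moreover have "p j = 1"
    using y by (auto simp: p_def Transposition.transpose_def)
  moreover have "p l = r"
    by (simp add: p_def y_def)
  moreover have tr: "Transposition.transpose a b z \<in> {1..r}"
    if "a \<in> {1..r}" "b \<in> {1..r}" "z \<in> {1..r}" for a b z
    using that by (simp add: Transposition.transpose_def)
  have "p z \<in> {1..r}" if "z \<in> {1..r}" for z
    unfolding p_def comp_apply using assms y that by (intro tr) auto
  then have "p ` {1..r} \<subseteq> {1..r}"
    by blast
  then have "p ` {1..r} = {1..r}"
    using \<open>bij p\<close> by (intro card_subset_eq) (auto simp: card_image bij_def inj_on_subset)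
  ultimately show thesis
    using that by blast
qed

lemma cls_relabel: "bij p \<Longrightarrow> cls n (p \<circ> c) (p i) = cls n c i"
  by (auto simp: cls_def bij_def inj_eq)

lemma block_graph_relabel:
  assumes "bij p" "p 0 = 0"
  shows "block_graph n (p \<circ> c) v N = block_graph n c v N"
proof -
  have "p x = p y \<longleftrightarrow> x = y" for x y
    using assms(1) by (simp add: bij_def inj_eq)
  then show ?thesis
    using assms(2) by (intro ext) (metis block_graph_def comp_apply)
qed

lemma relabel_range:
  assumes "p ` {1..r} = {1..r}" "p 0 = (0::nat)" "i \<le> r"
  shows "p i \<le> r"
  using assms by (cases "i = 0") (auto simp: set_eq_iff)

lemma config_relabel:
  assumes cfg: "config n k \<delta> r h c v N" and p: "bij p" "p 0 = 0" "p ` {1..r} = {1..r}"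
  shows "config n k \<delta> r h (p \<circ> c) v N"
proof -
  have inj: "p x = p y \<longleftrightarrow> x = y" for x y
    using p(1) by (simp add: bij_def inj_eq)
  have zero: "p x = 0 \<longleftrightarrow> x = 0" for x
    using inj[of x 0] p(2) by simp
  have "\<forall>i\<in>{1..r}. h + 1 \<le> card (cls n (p \<circ> c) i)"
  proof
    fix i assume "i \<in> {1..r}"
    then obtain i' where "i = p i'" "i' \<in> {1..r}"
      using p(3) by blast
    then show "h + 1 \<le> card (cls n (p \<circ> c) i)"
      using cfg cls_relabel[OF p(1), of n c i'] by (simp add: config_def)
  qed
  moreover have "card (cls n (p \<circ> c) 0) = k"
    using cfg cls_relabel[OF p(1), of n c 0] p(2) by (simp add: config_def)
  moreover have "\<forall>z<n. (p \<circ> c) z \<le> r"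
    using cfg relabel_range[OF p(3,2)] by (simp add: config_def)
  ultimately show ?thesis
    using cfg unfolding config_def by (auto simp: inj zero)
qed

section \<open>The extremal graph\<close>

lemma finite_climb:
  fixes R :: "'a \<Rightarrow> real"
  assumes fin: "finite (R ` F)" and step: "\<And>x. x \<in> F \<Longrightarrow> P x \<or> (\<exists>y\<in>F. R x < R y)" and x: "x \<in> F"
  shows "P x \<or> (\<exists>y\<in>F. P y \<and> R x < R y)"
proof (rule disjCI)
  assume no: "\<not> (\<exists>y\<in>F. P y \<and> R x < R y)"
  show "P x"
  proof (rule ccontr)
    assume "\<not> P x"
    \<comment> \<open>Among the elements above \<open>x\<close>, one with the largest value admits
      no further improvement, so it satisfies \<open>P\<close>.\<close>
    define Y where "Y = {y \<in> F. R x < R y}"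
    have "Y \<noteq> {}"
      using step[OF x] \<open>\<not> P x\<close> by (auto simp: Y_def)
    moreover have finY: "finite (R ` Y)"
      using fin by (rule finite_subset[rotated]) (auto simp: Y_def)
    ultimately have "Max (R ` Y) \<in> R ` Y"
      by (intro Max_in) auto
    then obtain y where y: "y \<in> Y" "R y = Max (R ` Y)"
      by (metis imageE)
    then obtain z where "z \<in> F" "R y < R z"
      using step[of y] no by (auto simp: Y_def)
    then have "z \<in> Y"
      using y by (auto simp: Y_def)
    then have "R z \<le> Max (R ` Y)"
      using finY by auto
    then show False
      using \<open>R y < R z\<close> y by simp
  qed
qed

lemma finite_simple_graphs: "finite {E. simple_graph n E}"
proof (rule inj_on_finite)
  show "inj_on (\<lambda>E. {p. E (fst p) (snd p)}) {E. simple_graph n E}"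
    by (rule inj_onI) (fastforce simp: fun_eq_iff set_eq_iff)
  show "(\<lambda>E. {p. E (fst p) (snd p)}) ` {E. simple_graph n E} \<subseteq> Pow ({..<n} \<times> {..<n})"
    by (auto simp: simple_graph_def)
qed simp

text \<open>The index set may be infinite, as labellings are free from \<open>n\<close> on; the
  values are finite in number because there are finitely many simple graphs.\<close>

lemma finite_block_graph_spec_rads:
  "finite ((\<lambda>x. spec_rad n (block_graph n (c x) (v x) (N x))) ` A)"
proof (rule finite_subset)
  show "(\<lambda>x. spec_rad n (block_graph n (c x) (v x) (N x))) ` A \<subseteq> spec_rad n ` {E. simple_graph n E}"
    using simple_graph_block_graph by blast
qed (intro finite_imageI finite_simple_graphs)

section \<open>The extremal graph as a block graph\<close>

text \<open>\<open>blk\<close> is 0 both on the \<open>K_k\<close> and on the large clique. The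
  shift reserves label 0 for the \<open>K_k\<close>, and the large clique becomes block 1.\<close>

definition ext_label :: "nat \<Rightarrow> nat \<Rightarrow> nat \<Rightarrow> nat \<Rightarrow> nat" where
  "ext_label k m q u = (if u < k then 0 else Suc (blk k m q u))"

lemma ext_label_eq_iff: "ext_label k m q u = 0 \<or> ext_label k m q w = 0 \<or> ext_label k m q u = ext_label k m q w
    \<longleftrightarrow> u < k \<or> w < k \<or> blk k m q u = blk k m q w"
  by (auto simp: ext_label_def)

lemma cls_ext_label_0: "k \<le> n \<Longrightarrow> cls n (ext_label k m q) 0 = {..<k}"
  by (auto simp: cls_def ext_label_def)

lemma cls_ext_label_block:
  assumes q: "q > 0" and n: "n = k + m + (r - 1) * q" and j: "j < r - 1"
  shows "cls n (ext_label k m q) (Suc (Suc j)) = {k + m + j * q..<k + m + Suc j * q}"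
proof -
  have le: "Suc j * q \<le> (r - 1) * q"
    using j by (intro mult_right_mono) auto
  have "ext_label k m q u = Suc (Suc j) \<longleftrightarrow> k + m + j * q \<le> u \<and> u < k + m + Suc j * q" for u
  proof (cases "k + m \<le> u")
    case True
    then have "ext_label k m q u = Suc (Suc j) \<longleftrightarrow> (u - k - m) div q = j"
      by (simp add: ext_label_def blk_def)
    also have "\<dots> \<longleftrightarrow> j \<le> (u - k - m) div q \<and> (u - k - m) div q < Suc j"
      by linarith
    also have "\<dots> \<longleftrightarrow> j * q \<le> u - k - m \<and> u - k - m < Suc j * q"
      using q by (simp only: less_eq_div_iff_mult_less_eq div_less_iff_less_mult)
    finally show ?thesis
      using True by linarith
  next
    case False
    then show ?thesis
      by (auto simp: ext_label_def blk_def)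
  qed
  moreover have "u < n" if "u < k + m + Suc j * q" for u
    using that le n by linarith
  ultimately have "u < n \<and> ext_label k m q u = Suc (Suc j) \<longleftrightarrow> u \<in> {k + m + j * q..<k + m + Suc j * q}" for u
    by (meson atLeastLessThan_iff)
  then show ?thesis
    unfolding cls_def by blast
qed

lemma ext_label_le:
  assumes "q > 0" "r \<ge> 1" "n = k + m + (r - 1) * q" "u < n"
  shows "ext_label k m q u \<le> r"
proof -
  have "(u - k - m) div q < r - 1" if "\<not> u < k + m"
    using that assms by (intro less_mult_imp_div_less) auto
  then show ?thesis
    using assms(2) by (auto simp: ext_label_def blk_def)
qed

lemma card_cls_ext_label:
  assumes "q > 0" "n = k + m + (r - 1) * q" "i \<in> {2..r}"
  shows "card (cls n (ext_label k m q) i) = q"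
proof -
  obtain j where "i = Suc (Suc j)" "j < r - 1"
    using assms(3) by (cases i; cases "i - 1") auto
  then show ?thesis
    using cls_ext_label_block[OF assms(1,2)] by simp
qed

lemma Gext3_eq_block_graph:
  "Gext3 n k \<delta> r = block_graph n (ext_label k (n - k - (r - 1) * (\<delta> - k + 1)) (\<delta> - k + 1)) n {}"
  by (intro ext) (auto simp: Gext3_def block_graph_def ext_label_eq_iff Let_def)

lemma Gext12_eq_block_graph:
  assumes "n > 0"
  shows "Gext12 n k \<delta> r h =
    block_graph n (ext_label k (n - k - (r - 1) * (h + 1)) (h + 1)) (n - 1) {u. wnb n k \<delta> r h u}"
  by (intro ext) (auto simp: Gext12_def block_graph_def ext_label_eq_iff Let_def)

lemma Gext12_config:
  assumes r: "r \<ge> 2" and h: "h \<ge> 1" and "\<delta> \<ge> 1" and n: "n \<ge> k + r * (h + 1)" and \<delta>: "\<delta> < k + h"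
  defines "c \<equiv> ext_label k (n - k - (r - 1) * (h + 1)) (h + 1)" and "N \<equiv> {u. wnb n k \<delta> r h u}"
  shows "config n k \<delta> r h c (n - 1) N" and "c (n - 1) = r"
    and "\<forall>i\<in>{2..r}. card (cls n c i) = h + 1" and "card (N \<inter> cls n c 0) = min (\<delta> - 1) k"
proof -
  define m where "m = n - k - (r - 1) * (h + 1)"
  define p where "p = k + m + (r - 2) * (h + 1)"
  have c: "c = ext_label k m (h + 1)"
    by (simp add: c_def m_def)
  have r1: "r * (h + 1) = (r - 1) * (h + 1) + (h + 1)"
    using r by (cases r) auto
  have nm: "n = k + m + (r - 1) * (h + 1)" "h + 1 \<le> m"
    using n r1 by (auto simp: m_def)
  have "r - 1 = Suc (r - 2)"
    using r by simp
  then have "(r - 1) * (h + 1) = (r - 2) * (h + 1) + (h + 1)"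
    by (metis add.commute mult_Suc)
  then have np: "n = p + (h + 1)"
    using nm by (simp add: p_def)
  have kp: "k + m \<le> p"
    by (simp add: p_def)
  have cls0: "cls n c 0 = {..<k}"
    unfolding c using nm by (intro cls_ext_label_0) auto
  show cards: "\<forall>i\<in>{2..r}. card (cls n c i) = h + 1"
    unfolding c using nm by (intro ballI card_cls_ext_label) auto
  \<comment> \<open>The \<open>K_h\<close> and the vertex \<open>n - 1\<close> together form block
    \<open>r\<close>, the last \<open>h + 1\<close> vertices.\<close>
  have clsr: "cls n c r = {p..<n}"
  proof -
    have "cls n c (Suc (Suc (r - 2))) = {k + m + (r - 2) * (h + 1)..<k + m + Suc (r - 2) * (h + 1)}"
      unfolding c using r by (intro cls_ext_label_block[OF _ nm(1)]) auto
    moreover have "Suc (Suc (r - 2)) = r" "k + m + Suc (r - 2) * (h + 1) = n"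
      using np r by (auto simp: p_def)
    ultimately show ?thesis
      unfolding p_def by metis
  qed
  then have cr: "c u = r" if "p \<le> u" "u < n" for u
    using that by (auto simp: cls_def set_eq_iff)
  then show cw: "c (n - 1) = r"
    using np by simp
  have c0: "c u = 0" if "u < k" for u
    using that by (simp add: c ext_label_def)
  have "{k..<k + m} \<subseteq> cls n c 1"
    using nm by (auto simp: cls_def c ext_label_def blk_def)
  then have "card {k..<k + m} \<le> card (cls n c 1)"
    by (intro card_mono) auto
  then have cls1: "h + 1 \<le> card (cls n c 1)"
    using nm by simp
  have blocks: "\<forall>i\<in>{1..r}. h + 1 \<le> card (cls n c i)"
  proof
    fix i assume "i \<in> {1..r}"
    then show "h + 1 \<le> card (cls n c i)"
      using cls1 cards by (cases "i = 1") auto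
  qed
  have N: "N = (if \<delta> \<le> k then {..<\<delta> - 1} \<union> {p} else {..<k} \<union> {p..<p + (\<delta> - k)})"
    by (auto simp: N_def wnb_def Let_def m_def p_def)
  have Nsub: "u < n \<and> u \<noteq> n - 1 \<and> (c u = 0 \<or> c u = r)" if "u \<in> N" for u
  proof (cases "u < k")
    case True
    then show ?thesis
      using c0 np kp h by auto
  next
    case False
    \<comment> \<open>The conditions \<open>h >= 1\<close> and \<open>\<delta> < k + h\<close> keep
      the neighbours of the special vertex below \<open>n - 1\<close>.\<close>
    then have "p \<le> u" "u < n - 1"
      using that np h \<delta> kp by (auto simp: N split: if_splits)
    then show ?thesis
      using cr by auto
  qed
  have pN: "p \<in> N"
    using \<delta> by (auto simp: N)
  have "card N = \<delta>"
  proof (cases "\<delta> \<le> k")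
    case True
    then have "card N = card {..<\<delta> - 1} + card {p}"
      unfolding N using kp by (simp only: if_True) (intro card_Un_disjoint, auto)
    then show ?thesis
      using \<open>\<delta> \<ge> 1\<close> by simp
  next
    case False
    then have "card N = card {..<k} + card {p..<p + (\<delta> - k)}"
      unfolding N using kp by (simp only: if_False) (intro card_Un_disjoint, auto)
    then show ?thesis
      using False by simp
  qed
  moreover have "\<forall>z<n. c z \<le> r"
    unfolding c using nm r by (intro allI impI ext_label_le) auto
  moreover have "\<exists>z\<in>N. c z = c (n - 1)"
    using pN cr np cw by (intro bexI[of _ p]) auto
  ultimately show "config n k \<delta> r h c (n - 1) N"
    using blocks Nsub cls0 np r unfolding config_def cw by auto
  have "N \<inter> cls n c 0 = {..<min (\<delta> - 1) k}"
    unfolding N cls0 using kp nm \<delta> by auto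
  then show "card (N \<inter> cls n c 0) = min (\<delta> - 1) k"
    by simp
qed

section \<open>Upper bounds for block graphs\<close>

text \<open>The climb from the given configuration stops at a terminal one, which renumbering turns
  into the extremal graph.\<close>

lemma config_spec_rad_le:
  assumes cfg: "config n k \<delta> r h c v N"
    and k: "k \<ge> 1" and r: "r \<ge> 2" and h: "h \<ge> 1" and \<delta>1: "\<delta> \<ge> 1" and n: "n \<ge> k + r * (h + 1)" and \<delta>: "\<delta> < k + h"
  shows "graph_iso n (block_graph n c v N) (Gext12 n k \<delta> r h) \<or>
    spec_rad n (block_graph n c v N) < spec_rad n (Gext12 n k \<delta> r h)"
proof -
  define F where "F = {(c, v, N). config n k \<delta> r h c v N}"
  define B where "B x = block_graph n (fst x) (fst (snd x)) (snd (snd x))" for x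
  have n0: "n > 0"
    using n k by simp
  note G = Gext12_config[OF r h \<delta>1 n \<delta>]
  have "graph_iso n (B x) (Gext12 n k \<delta> r h) \<or> (\<exists>y\<in>F. spec_rad n (B x) < spec_rad n (B y))" if xF: "x \<in> F" for x
  proof -
    obtain c v N where x: "x = (c, v, N)"
      by (metis prod_cases3)
    then have cfg: "config n k \<delta> r h c v N"
      using xF by (simp add: F_def)
    from improve_or_terminal[OF cfg k r h \<delta>] show ?thesis
    proof
      assume "card (N \<inter> cls n c 0) = min (\<delta> - 1) k \<and>
        (\<exists>j\<in>{1..r}. j \<noteq> c v \<and> (\<forall>i\<in>{1..r}. i \<noteq> j \<longrightarrow> card (cls n c i) = h + 1))"
      then obtain j where N0: "card (N \<inter> cls n c 0) = min (\<delta> - 1) k"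
        and j: "j \<in> {1..r}" "j \<noteq> c v" "\<And>i. i \<in> {1..r} \<Longrightarrow> i \<noteq> j \<Longrightarrow> card (cls n c i) = h + 1"
        by blast
      have "c v \<in> {1..r}"
        using cfg by (auto simp: config_def)
      then obtain p where p: "bij p" "p 0 = 0" "p ` {1..r} = {1..r}" "p j = 1" "p (c v) = r"
        using relabel_permutation[OF j(1) _ j(2)] by metis
      have "\<forall>i\<in>{2..r}. card (cls n (p \<circ> c) i) = h + 1"
      proof
        fix i assume i: "i \<in> {2..r}"
        then obtain i' where "i' \<in> {1..r}" "i = p i'"
          using p(3) by (metis atLeastAtMost_iff imageE le_trans one_le_numeral)
        moreover have "i' \<noteq> j"
          using i p(4) \<open>i = p i'\<close> by auto
        ultimately show "card (cls n (p \<circ> c) i) = h + 1"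
          using j(3) cls_relabel[OF p(1), of n c i'] by simp
      qed
      moreover have "N \<inter> cls n (p \<circ> c) 0 = N \<inter> cls n c 0"
        using cls_relabel[OF p(1), of n c 0] p(2) by simp
      ultimately have "graph_iso n (block_graph n (p \<circ> c) v N) (Gext12 n k \<delta> r h)"
        unfolding Gext12_eq_block_graph[OF n0] using N0 G p(5)
        by (intro terminal_config_iso[OF config_relabel[OF cfg p(1-3)] G(1) r]) auto
      then show ?thesis
        by (simp add: block_graph_relabel[OF p(1,2)] B_def x)
    next
      assume "\<exists>c' v' N'. config n k \<delta> r h c' v' N' \<and>
        spec_rad n (block_graph n c v N) < spec_rad n (block_graph n c' v' N')"
      then obtain c' v' N' where "config n k \<delta> r h c' v' N'"
          "spec_rad n (block_graph n c v N) < spec_rad n (block_graph n c' v' N')"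
        by blast
      then show ?thesis
        by (intro disjI2 bexI[of _ "(c', v', N')"]) (auto simp: F_def B_def x)
    qed
  qed
  moreover have "finite ((\<lambda>x. spec_rad n (B x)) ` F)"
    unfolding B_def by (rule finite_block_graph_spec_rads)
  moreover have "(c, v, N) \<in> F"
    using cfg by (simp add: F_def)
  ultimately have "graph_iso n (B (c, v, N)) (Gext12 n k \<delta> r h) \<or>
      (\<exists>y\<in>F. graph_iso n (B y) (Gext12 n k \<delta> r h) \<and> spec_rad n (B (c, v, N)) < spec_rad n (B y))"
    using finite_climb[of "\<lambda>x. spec_rad n (B x)" F "\<lambda>x. graph_iso n (B x) (Gext12 n k \<delta> r h)"] by blast
  then show ?thesis
    using spec_rad_graph_iso by (fastforce simp: B_def)
qed

lemma part_no_special: "part n c n i = cls n c i"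
  by (auto simp: part_def cls_def)

text \<open>The analogue without special vertex: balancing is the only move, and it ends with at
  most one block larger than \<open>q\<close>.\<close>

lemma clique_blocks_spec_rad_le:
  assumes c: "\<forall>z<n. c z \<le> r" "card (cls n c 0) = k" "\<forall>i\<in>{1..r}. q \<le> card (cls n c i)"
    and k: "k \<ge> 1" and r: "r \<ge> 2" and q: "q \<ge> 1"
  defines "G \<equiv> block_graph n (ext_label k (n - k - (r - 1) * q) q) n {}"
  shows "graph_iso n (block_graph n c n {}) G \<or> spec_rad n (block_graph n c n {}) < spec_rad n G"
proof -
  define F where "F = {c. (\<forall>z<n. c z \<le> r) \<and> card (cls n c 0) = k \<and> (\<forall>i\<in>{1..r}. q \<le> card (cls n c i))}"
  define m where "m = n - k - (r - 1) * q"
  \<comment> \<open>The block sizes show that there is room for \<open>r\<close> blocks of size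
    \<open>q\<close>, so the truncated subtraction in \<open>m\<close> is exact.\<close>
  have "k + (\<Sum>i\<in>{1..r}. q) \<le> card (cls n c 0) + (\<Sum>i\<in>{1..r}. card (cls n c i))"
    using c by (intro add_mono sum_mono) auto
  also have "\<dots> = (\<Sum>i\<le>r. card (cls n c i))"
    by (simp add: atMost_atLeast0 sum.atLeast_Suc_atMost)
  also have "\<dots> = n"
    by (rule sum_card_cls[OF c(1)])
  finally have "k + r * q \<le> n"
    by simp
  moreover have "(r - 1) * q \<le> r * q"
    by (intro mult_right_mono) auto
  ultimately have nm: "n = k + m + (r - 1) * q"
    unfolding m_def by linarith
  have "graph_iso n (block_graph n c n {}) G \<or>
      (\<exists>c'\<in>F. spec_rad n (block_graph n c n {}) < spec_rad n (block_graph n c' n {}))" if "c \<in> F" for c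
  proof (rule disjCI)
    assume no: "\<not> (\<exists>c'\<in>F. spec_rad n (block_graph n c n {}) < spec_rad n (block_graph n c' n {}))"
    have c: "\<forall>z<n. c z \<le> r" "card (cls n c 0) = k" "\<forall>i\<in>{1..r}. q \<le> card (cls n c i)"
      using \<open>c \<in> F\<close> by (auto simp: F_def)
    have "card (cls n c 0) \<noteq> 0"
      using c k by simp
    then obtain d where "d < n" "c d = 0"
      using cls_witness by blast
    then have "radius2 n (block_graph n c n {})"
      by (intro radius2_block_graph[of d]) auto
    then obtain f where f: "adj_eigvec n (block_graph n c n {}) (spec_rad n (block_graph n c n {})) f"
        "\<forall>i<n. 0 < f i"
      using spec_rad_pos_eigvec[OF simple_graph_block_graph] by blast
    have no_move: False
      if st: "s \<in> {1..r}" "t \<in> {1..r}" "s \<noteq> t" "q < card (cls n c s)"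
        and le: "sum f (part n c n s) \<le> sum f (part n c n t)" for s t
    proof -
      have "card (cls n c s) \<noteq> 0"
        using st(4) by linarith
      then obtain x where x: "x < n" "c x = s"
        using cls_witness by blast
      have "\<forall>i\<in>{1..r}. q \<le> card (cls n (c(x := t)) i)"
        using c x st by (intro blocks_upd) auto
      moreover have "cls n (c(x := t)) 0 = cls n c 0"
        using x st by (intro cls_upd_other) auto
      ultimately have "c(x := t) \<in> F"
        using c st by (auto simp: F_def)
      moreover have "spec_rad n (block_graph n c n {}) < spec_rad n (block_graph n (c(x := t)) n {})"
        using x st le by (intro spec_rad_move_vertex[OF _ _ _ _ _ _ f]) auto
      ultimately show False
        using no by blast
    qed
    have two: "i = j" if "i \<in> {1..r}" "j \<in> {1..r}" "q < card (cls n c i)" "q < card (cls n c j)" for i j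
      using no_move[of i j] no_move[of j i] that linear[of "sum f (part n c n i)" "sum f (part n c n j)"]
      by blast
    have eq: "card (cls n c i) = q" if "i \<in> {1..r}" "\<not> q < card (cls n c i)" for i
      using that c(3) by (meson le_antisym not_le)
    have "1 \<in> {1..r}"
      using r by simp
    then obtain j where j: "j \<in> {1..r}" "\<And>i. i \<in> {1..r} \<Longrightarrow> i \<noteq> j \<Longrightarrow> card (cls n c i) = q"
      using two eq by metis
    define l where "l = (if j = 1 then 2 else 1 :: nat)"
    have "l \<in> {1..r}" "j \<noteq> l"
      using r by (auto simp: l_def)
    then obtain p where p: "bij p" "p 0 = 0" "p ` {1..r} = {1..r}" "p j = 1"
      using relabel_permutation[OF j(1)] by metis
    have cards: "card (cls n (p \<circ> c) i) = card (cls n (ext_label k m q) i)" if "i \<le> r" "i \<noteq> 1" for i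
    proof (cases "i = 0")
      case True
      then show ?thesis
        using cls_relabel[OF p(1), of n c 0] p(2) c(2) cls_ext_label_0[of k n m q] nm by simp
    next
      case False
      then have i: "i \<in> {2..r}"
        using that by auto
      then obtain i' where "i' \<in> {1..r}" "i = p i'"
        using p(3) by (metis atLeastAtMost_iff imageE le_trans one_le_numeral)
      moreover have "i' \<noteq> j"
        using i p(4) \<open>i = p i'\<close> by auto
      ultimately have "card (cls n (p \<circ> c) i) = q"
        using j(2) cls_relabel[OF p(1), of n c i'] by simp
      then show ?thesis
        using card_cls_ext_label[OF _ nm i] q by simp
    qed
    have lab: "\<forall>z<n. (p \<circ> c) z \<le> r" "\<forall>z<n. ext_label k m q z \<le> r"
      using c(1) relabel_range[OF p(3,2)] ext_label_le[OF _ _ nm] q r by auto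
    have "card (cls n (p \<circ> c) i) = card (cls n (ext_label k m q) i)" for i
      using r by (intro card_cls_eqI[OF lab _ cards]) simp_all
    then have "graph_iso n (block_graph n (p \<circ> c) n {}) G"
      unfolding G_def m_def[symmetric] by (intro block_graph_iso) (simp_all add: part_no_special)
    then show "graph_iso n (block_graph n c n {}) G"
      by (simp add: block_graph_relabel[OF p(1,2)])
  qed
  moreover have "finite ((\<lambda>c. spec_rad n (block_graph n c n {})) ` F)"
    by (rule finite_block_graph_spec_rads)
  moreover have "c \<in> F"
    using c by (simp add: F_def)
  ultimately have "graph_iso n (block_graph n c n {}) G \<or> (\<exists>c'\<in>F. graph_iso n (block_graph n c' n {}) G \<and>
      spec_rad n (block_graph n c n {}) < spec_rad n (block_graph n c' n {}))"
    using finite_climb[of "\<lambda>c. spec_rad n (block_graph n c n {})" F "\<lambda>c. graph_iso n (block_graph n c n {}) G"]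
    by blast
  then show ?thesis
    using spec_rad_graph_iso by fastforce
qed

section \<open>From a cut to a labelling, and the theorem\<close>

lemma hr_cut_labelling:
  assumes E: "simple_graph n E" and cut: "hr_cut n E r h S" and h: "h \<ge> 1" and r: "r \<ge> 1"
  obtains c where "\<forall>z<n. c z \<le> r" "cls n c 0 = S" "\<forall>i\<in>{1..r}. h + 1 \<le> card (cls n c i)"
    "\<And>a b. E a b \<Longrightarrow> c a = 0 \<or> c b = 0 \<or> c a = c b"
    "\<And>a. a < n \<Longrightarrow> c a \<noteq> 0 \<Longrightarrow> \<exists>b. E a b \<and> c b = c a"
proof -
  define V where "V = {0..<n} - S"
  define A where "A = (\<lambda>x y. E x y \<and> x \<in> V \<and> y \<in> V)"
  define comp where "comp x = {y \<in> V. A\<^sup>*\<^sup>* x y}" for x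
  define C where "C = comp ` V"
  have "components_del n E S = C"
    by (simp add: components_del_def C_def comp_def V_def A_def Let_def)
  then have S: "S \<subseteq> {0..<n}" and rC: "r \<le> card C" and big: "\<And>X. X \<in> C \<Longrightarrow> h + 1 \<le> card X"
    using cut by (auto simp: hr_cut_def)
  have "symp A"
    using E by (auto simp: A_def simple_graph_def symp_def)
  then have sym: "A\<^sup>*\<^sup>* x y \<Longrightarrow> A\<^sup>*\<^sup>* y x" for x y
    by (metis sympD symp_rtranclp)
  have comp_eq: "comp x = comp y" if "A\<^sup>*\<^sup>* x y" for x y
    using that sym unfolding comp_def by (auto intro: rtranclp_trans)
  have "finite C"
    by (simp add: C_def V_def)
  then obtain e where e: "bij_betw e C {0..<card C}"
    using ex_bij_betw_finite_nat by blast
  \<comment> \<open>The components numbered from \<open>r\<close> on are merged into block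
    \<open>r\<close>. Merging only enlarges a block, so the lower bound on the sizes
    survives.\<close>
  define c where "c z = (if z \<in> V then min r (Suc (e (comp z))) else 0)" for z
  have c0: "c z = 0 \<longleftrightarrow> z \<notin> V" for z
    using r by (simp add: c_def)
  have same: "c x = c y" if "A\<^sup>*\<^sup>* x y" "x \<in> V" "y \<in> V" for x y
    using that comp_eq by (simp add: c_def)
  show thesis
  proof
    show "\<forall>z<n. c z \<le> r"
      by (simp add: c_def)
    show "cls n c 0 = S"
      using S by (auto simp: cls_def c0 V_def)
    show "\<forall>i\<in>{1..r}. h + 1 \<le> card (cls n c i)"
    proof
      fix i assume i: "i \<in> {1..r}"
      then have "i - 1 \<in> e ` C"
        using e rC by (auto simp: bij_betw_def)
      then obtain x where x: "x \<in> V" "e (comp x) = i - 1"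
        by (auto simp: C_def)
      then have cx: "c x = i"
        using i by (simp add: c_def)
      have "comp x \<subseteq> cls n c i"
      proof
        fix y assume "y \<in> comp x"
        then have "y \<in> V" "A\<^sup>*\<^sup>* x y"
          by (auto simp: comp_def)
        then show "y \<in> cls n c i"
          using same[of x y] x cx by (auto simp: cls_def V_def)
      qed
      then have "card (comp x) \<le> card (cls n c i)"
        by (intro card_mono) auto
      then show "h + 1 \<le> card (cls n c i)"
        using big[of "comp x"] x by (simp add: C_def)
    qed
    show "c a = 0 \<or> c b = 0 \<or> c a = c b" if "E a b" for a b
      using same[of a b] that by (auto simp: c0 A_def)
    show "\<exists>b. E a b \<and> c b = c a" if "a < n" "c a \<noteq> 0" for a
    proof -
      have a: "a \<in> V"
        using that(2) by (simp add: c0)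
      \<comment> \<open>A component has at least \<open>h + 1 >= 2\<close> vertices, so a path from
        \<open>a\<close> to another vertex starts with a neighbour of \<open>a\<close> in the same
        component.\<close>
      have "\<not> comp a \<subseteq> {a}"
      proof
        assume "comp a \<subseteq> {a}"
        then have "card (comp a) \<le> card {a}"
          by (intro card_mono) auto
        then show False
          using big[of "comp a"] a h by (simp add: C_def)
      qed
      then obtain y where "A\<^sup>*\<^sup>* a y" "y \<noteq> a"
        by (auto simp: comp_def)
      then obtain b where "A a b"
        by (metis converse_rtranclpE)
      then have "E a b" "c a = c b"
        using same[of a b] a by (auto simp: A_def)
      then show ?thesis
        by auto
    qed
  qed
qed

theorem theorem1p2:
  fixes n k \<delta> r h :: nat and E :: "nat \<Rightarrow> nat \<Rightarrow> bool"
  assumes "r \<ge> 2" and "h \<ge> 1" and "k \<ge> 1" and "\<delta> \<ge> 1"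
    and "n \<ge> k + r * (h + 1)"
    and "simple_graph n E"
    and "kappa_hr n E r h = k"
    and "min_degree n E = \<delta>"
  shows "spec_rad n E \<le> spec_rad n (Gext n k \<delta> r h)
    \<and> (spec_rad n E = spec_rad n (Gext n k \<delta> r h) \<longleftrightarrow> graph_iso n E (Gext n k \<delta> r h))"
proof -
  note r = assms(1) and h = assms(2) and k = assms(3) and E = assms(6)
  have n0: "n > 0" and r1: "r \<ge> 1"
    using assms(1,3,5) by simp_all
  have finS: "finite {S. hr_cut n E r h S}"
    by (rule finite_subset[of _ "Pow {0..<n}"]) (auto simp: hr_cut_def)
  \<comment> \<open>\<open>k >= 1\<close> excludes the default value 0 of \<open>kappa_hr\<close>,
    so a cut exists.\<close>
  have "\<exists>S. hr_cut n E r h S"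
    using assms(3,7) by (auto simp: kappa_hr_def split: if_splits)
  then have "k \<in> card ` {S. hr_cut n E r h S}"
    using assms(7) finS Min_in[of "card ` {S. hr_cut n E r h S}"] by (auto simp: kappa_hr_def)
  then obtain S where S: "hr_cut n E r h S" "card S = k"
    by blast
  obtain c where c: "\<forall>z<n. c z \<le> r" "cls n c 0 = S" "\<forall>i\<in>{1..r}. h + 1 \<le> card (cls n c i)"
      "\<And>a b. E a b \<Longrightarrow> c a = 0 \<or> c b = 0 \<or> c a = c b"
      "\<And>a. a < n \<Longrightarrow> c a \<noteq> 0 \<Longrightarrow> \<exists>b. E a b \<and> c b = c a"
    using hr_cut_labelling[OF E S(1) h r1] by blast
  have c0: "card (cls n c 0) = k"
    using c(2) S(2) by simp
  have deg: "degree n E v = card (nbrs n E v)" for v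
    by (simp add: degree_def nbrs_def)
  have "\<delta> \<in> degree n E ` {0..<n}"
    unfolding assms(8)[symmetric] min_degree_def using n0 by (intro Min_in) auto
  then obtain v where v: "v < n" "card (nbrs n E v) = \<delta>"
    by (auto simp: deg)
  have min: "\<delta> \<le> card (nbrs n E u)" if "u < n" for u
    unfolding assms(8)[symmetric] min_degree_def deg[symmetric] using that by (intro Min_le) auto
  have Eprops: "a < n" "b < n" "a \<noteq> b" "E b a" if "E a b" for a b
    using E that by (auto simp: simple_graph_def)
  \<comment> \<open>This dichotomy yields both claims, since isomorphic graphs have equal
    radius.\<close>
  have "graph_iso n E (Gext n k \<delta> r h) \<or> spec_rad n E < spec_rad n (Gext n k \<delta> r h)"
  proof (cases "k + h \<le> \<delta>")
    case True
    define q where "q = \<delta> - k + 1"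
    have G: "Gext n k \<delta> r h = block_graph n (ext_label k (n - k - (r - 1) * q) q) n {}"
      using True by (simp add: Gext_def Gext3_eq_block_graph q_def)
    let ?H = "block_graph n c n {}"
    have blocks: "\<forall>i\<in>{1..r}. q \<le> card (cls n c i)"
    proof
      fix i assume i: "i \<in> {1..r}"
      then have "h + 1 \<le> card (cls n c i)"
        using c(3) by blast
      then have "card (cls n c i) \<noteq> 0"
        by linarith
      then obtain u where u: "u < n" "c u = i"
        using cls_witness by blast
      \<comment> \<open>At least \<open>\<delta>\<close> neighbours of \<open>u\<close> lie in the
        cut or in its own block, whence the block has at least \<open>\<delta> - k + 1\<close>
        vertices.\<close>
      have "nbrs n E u \<subseteq> cls n c 0 \<union> (cls n c i - {u})"
      proof
        fix w assume "w \<in> nbrs n E u"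
        then show "w \<in> cls n c 0 \<union> (cls n c i - {u})"
          using c(4)[of u w] Eprops[of u w] u i by (auto simp: nbrs_def cls_def)
      qed
      then have "card (nbrs n E u) \<le> card (cls n c 0 \<union> (cls n c i - {u}))"
        by (intro card_mono) auto
      also have "\<dots> \<le> k + card (cls n c i - {u})"
        using card_Un_le[of "cls n c 0"] c0 by simp
      also have "card (cls n c i - {u}) = card (cls n c i) - 1"
        using u by (simp add: cls_def)
      finally show "q \<le> card (cls n c i)"
        using min[OF u(1)] True h \<open>card (cls n c i) \<noteq> 0\<close> by (simp add: q_def)
    qed
    have "card (cls n c 0) \<noteq> 0"
      using c0 k by simp
    then obtain d where d: "d < n" "c d = 0"
      using cls_witness by blast
    then have rad: "radius2 n ?H"
      by (intro radius2_block_graph[of d]) auto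
    have sub: "?H a b" if "E a b" for a b
      using Eprops[OF that] c(4)[OF that] by (auto simp: block_graph_def)
    note le = spec_rad_mono[OF n0 E simple_graph_block_graph sub]
      spec_rad_subgraph_eq[OF n0 E simple_graph_block_graph rad sub]
    have "graph_iso n ?H (Gext n k \<delta> r h) \<or> spec_rad n ?H < spec_rad n (Gext n k \<delta> r h)"
      unfolding G by (rule clique_blocks_spec_rad_le[OF c(1) c0 blocks k r]) (simp add: q_def)
    then show ?thesis
      using le spec_rad_graph_iso by (metis le_less_trans order_le_less)
  next
    case False
    then have \<delta>: "\<delta> < k + h"
      by simp
    have G: "Gext n k \<delta> r h = Gext12 n k \<delta> r h"
      using False by (simp add: Gext_def)
    note upper = config_spec_rad_le[OF _ k r h assms(4,5) \<delta>]
    define N where "N = nbrs n E v"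
    have N: "N \<subseteq> {..<n} - {v}" "card N = \<delta>"
      using v E by (auto simp: N_def nbrs_def simple_graph_def)
    \<comment> \<open>Cut and blocks are completed to cliques while the neighbourhood of
      \<open>v\<close> is frozen, so \<open>v\<close> still has degree \<open>\<delta>\<close> in
      this supergraph of \<open>E\<close>.\<close>
    let ?H = "block_graph n c v N"
    have sub: "?H a b" if "E a b" for a b
      using Eprops[OF that] c(4)[OF that] that by (auto simp: block_graph_def N_def nbrs_def)
    show ?thesis
    proof (cases "c v = 0")
      case True
      \<comment> \<open>The two promotion lemmas cover the cases that \<open>v\<close> has or lacks
        a neighbour outside the cut.\<close>
      have "\<exists>c' N'. config n k \<delta> r h c' v N' \<and> spec_rad n ?H < spec_rad n (block_graph n c' v N')"
        using promote_with_block_nbr[OF v(1) True c(1) c0 c(3) N _ _ r h \<delta>]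
          promote_without_block_nbr[OF v(1) True c(1) c0 c(3) N _ assms(4) r h] by blast
      then obtain c' N' where cfg: "config n k \<delta> r h c' v N'"
        and less: "spec_rad n ?H < spec_rad n (block_graph n c' v N')"
        by blast
      have "spec_rad n E \<le> spec_rad n ?H"
        by (rule spec_rad_mono[OF n0 E simple_graph_block_graph sub])
      then show ?thesis
        using less upper[OF cfg] spec_rad_graph_iso unfolding G by fastforce
    next
      case cv: False
      have "N \<subseteq> {z. z < n \<and> z \<noteq> v \<and> (c z = 0 \<or> c z = c v)}"
        using N(1) c(4)[of v] cv by (fastforce simp: N_def nbrs_def)
      moreover have "\<exists>z\<in>N. c z = c v"
        using c(5)[OF v(1) cv] Eprops(2) unfolding N_def nbrs_def by blast
      ultimately have cfg: "config n k \<delta> r h c v N"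
        using v c c0 cv N unfolding config_def by blast
      note le = spec_rad_mono[OF n0 E simple_graph_block_graph sub]
      spec_rad_subgraph_eq[OF n0 E simple_graph_block_graph config_radius2[OF cfg k] sub]
      show ?thesis
        using le upper[OF cfg] spec_rad_graph_iso unfolding G by (metis le_less_trans order_le_less)
    qed
  qed
  then show ?thesis
    using spec_rad_graph_iso by fastforce
qed

end
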